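(* For every integer $n\geqslant 2$ and every tuple $\mathbf{m}=(m_1,\ldots,m_n)$ of positive integers there exist positive real constants $C_1(\mathbf{m},n)$, $C_2(\mathbf{m},n)$, $C_3(\mathbf{m},n)$, depending only on $n$ and $\mathbf{m}$, such that the following holds. Let $p$ be a prime, let $\Gamma$ be a subgroup of $\mathbb{F}_p^*$, let $\Gamma_1,\ldots,\Gamma_n$ be cosets of $\Gamma$ in $\mathbb{F}_p^*$ (that is, $\Gamma_i=g_i\Gamma$ with $g_i\in\mathbb{F}_p^*$), and let $f_1(x),\ldots,f_n(x)\in\mathbb{F}_p[x]$ be an admissible set of polynomials with $\deg f_i=m_i$ for $i=1,\ldots,n$. Suppose that $$C_1(\mathbf{m},n)<|\Gamma|<C_2(\mathbf{m},n)\,p^{1-\frac{1}{2n+1}}.$$ Then the set $$M=\{x\in\mathbb{F}_p \mid f_i(x)\in\Gamma_i,\ i=1,\ldots,n\}$$ satisfies $$|M|\leqslant C_3(\mathbf{m},n)\,|\Gamma|^{\frac12+\frac1{2n}}.$$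
   Context: $\mathbb{F}_p=\mathbb{Z}/p\mathbb{Z}$ and $\mathbb{F}_p^*$ is its multiplicative group. A set (tuple) of polynomials $f_1(x),\ldots,f_n(x)\in\mathbb{F}_p[x]$ is called admissible if there exist $x_1,\ldots,x_n\in\mathbb{F}_p$ such that $f_i(x_i)=0$ and $f_j(x_i)\neq 0$ for all $1\leqslant i,j\leqslant n$ with $j\neq i$, and moreover $f_i(0)\neq 0$ for $i=1,\ldots,n$. *)

theory Defs
  imports
    Complex_Main
    "HOL-Number_Theory.Residues"
    "HOL-Algebra.Polynomial_Divisibility"
begin

text \<open>
  The prime is a bound variable of the main statement, so the field with \<open>p\<close> elements is the
  carrier-based ring \<^term>\<open>residue_ring (int p)\<close>, its multiplicative group is
  \<open>mult_of\<close> of that ring, and polynomials are the coefficient lists of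
  \<^theory>\<open>HOL-Algebra.Polynomials\<close> (leading coefficient first and nonzero; the zero
  polynomial is the empty list).
  Tuples of length \<open>n\<close> are functions on \<open>{1..n}\<close>.
\<close>

abbreviation Fp :: "nat \<Rightarrow> int ring"
  where "Fp p \<equiv> residue_ring (int p)"

abbreviation Fp_star :: "nat \<Rightarrow> int monoid"
  where "Fp_star p \<equiv> Multiplicative_Group.mult_of (Fp p)"

definition admissible_polys :: "nat \<Rightarrow> nat \<Rightarrow> (nat \<Rightarrow> int list) \<Rightarrow> bool"
  where "admissible_polys p n f \<longleftrightarrow>
    (\<forall>i\<in>{1..n}. f i \<in> carrier (poly_ring (Fp p))) \<and>
    (\<exists>x. \<forall>i\<in>{1..n}.
       x i \<in> carrier (Fp p) \<and>
       ring.eval (Fp p) (f i) (x i) = \<zero>\<^bsub>Fp p\<^esub> \<and>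
       (\<forall>j\<in>{1..n}. j \<noteq> i \<longrightarrow> ring.eval (Fp p) (f j) (x i) \<noteq> \<zero>\<^bsub>Fp p\<^esub>)) \<and>
    (\<forall>i\<in>{1..n}. ring.eval (Fp p) (f i) \<zero>\<^bsub>Fp p\<^esub> \<noteq> \<zero>\<^bsub>Fp p\<^esub>)"

end

theory Submission
  imports Defs "HOL-Computational_Algebra.Polynomial_Factorial"
begin

text \<open>
  Stepanov's method. Let \<open>t\<close> be the order of the subgroup and \<open>G = \<Prod>\<^sub>i f\<^sub>i\<close>. Put
  \<open>E\<^sub>b = \<Prod>\<^sub>i f\<^sub>i ^ (t b\<^sub>i)\<close>, which is constant on \<open>M\<close>. For the derivation \<open>\<theta> q = G q'\<close>,
  \<open>\<theta>\<^sup>k (P E\<^sub>b)\<close> is \<open>E\<^sub>b\<close> times a polynomial of degree at most \<open>deg P + k deg G\<close>, so with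
  \<open>N = B\<^sup>n\<close> exponent vectors \<open>b\<close> and \<open>deg P\<^sub>b < N\<close>, linear algebra gives a nontrivial
  \<open>\<Psi> = \<Sum>\<^sub>b P\<^sub>b E\<^sub>b\<close> vanishing on \<open>M\<close> to an order \<open>D\<close> comparable to \<open>N\<close>. If \<open>\<Psi> \<noteq> 0\<close>, this
  yields \<open>D |M| \<le> deg \<Psi>\<close>, and \<open>B\<close> of size \<open>t\<close> to the power \<open>1 / (2 n)\<close> gives the bound.

  To see \<open>\<Psi> \<noteq> 0\<close>, take a relation \<open>\<Sum>\<^sub>b P\<^sub>b E\<^sub>b = 0\<close> with the fewest nonzero terms and drop one of
  them, say \<open>b'\<close>; the remaining terms are linearly independent. Some operator \<open>\<Sum>\<^sub>j c\<^sub>j \<theta>\<^sup>j\<close> of order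
  below their number, with coefficients of small degree, annihilates all of them but one, say \<open>b\<close>, and
  it cannot annihilate that one too. What is left is \<open>R E\<^sub>b + R' E\<^sub>b\<^sub>' = 0\<close> with \<open>R \<noteq> 0\<close> and
  \<open>R\<close>, \<open>R'\<close> of degree below \<open>t\<close>. Comparing orders at a root of \<open>f\<^sub>i\<close> that is not a root of
  the other \<open>f\<^sub>j\<close>, where \<open>b\<close> and \<open>b'\<close> differ at \<open>i\<close>, this is absurd.

  Polynomials over the field with \<open>p\<close> elements are represented by integer polynomials, with
  \<open>[:p:] dvd q\<close> in the role of \<open>q = 0\<close>.
\<close>

hide_const (open) Divisibility.prime Polynomials.degree

section \<open>Linear systems modulo a prime\<close>

text \<open>Pigeonhole: there are \<open>p ^ card U\<close> reduced vectors but only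
  \<open>p ^ card E\<close> possible values of the system modulo \<open>p\<close>. The difference of
  two distinct vectors with equal values is the solution.\<close>

lemma exists_mod_solution:
  fixes p :: int and a :: "'e \<Rightarrow> 'u \<Rightarrow> int"
  assumes p: "p > 1" and U: "finite U" and E: "finite E" and less: "card E < card U"
  shows "\<exists>c. (\<exists>u\<in>U. \<not> p dvd c u) \<and> (\<forall>e\<in>E. p dvd (\<Sum>u\<in>U. c u * a e u))"
proof -
  let ?V = "U \<rightarrow>\<^sub>E {0..<p}" and ?W = "E \<rightarrow>\<^sub>E {0..<p}"
  let ?\<phi> = "\<lambda>c. \<lambda>e\<in>E. (\<Sum>u\<in>U. c u * a e u) mod p"
  have "card ?W < card ?V"
    using p less by (simp add: card_PiE U E)
  moreover have "?\<phi> ` ?V \<subseteq> ?W"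
    using p by auto
  moreover have "finite ?W"
    using E by (simp add: finite_PiE)
  ultimately have "\<not> inj_on ?\<phi> ?V"
    using card_inj_on_le leD by blast
  then obtain c d where cd: "c \<in> ?V" "d \<in> ?V" "c \<noteq> d" "?\<phi> c = ?\<phi> d"
    unfolding inj_on_def by blast
  then obtain u where u: "u \<in> U" "c u \<noteq> d u"
    using PiE_ext[OF cd(1,2)] by blast
  have "\<not> p dvd c u - d u"
  proof
    assume "p dvd c u - d u"
    then have "c u mod p = d u mod p" by (simp add: mod_eq_dvd_iff)
    moreover have "c u \<in> {0..<p}" "d u \<in> {0..<p}" using cd u by auto
    ultimately show False using u by simp
  qed
  moreover have "p dvd (\<Sum>u\<in>U. (c u - d u) * a e u)" if "e \<in> E" for e
  proof -
    have "(\<Sum>u\<in>U. c u * a e u) mod p = (\<Sum>u\<in>U. d u * a e u) mod p"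
      using fun_cong[OF cd(4), of e] that by simp
    then show ?thesis by (simp add: mod_eq_dvd_iff left_diff_distrib sum_subtractf)
  qed
  ultimately show ?thesis using u(1) by (intro exI[of _ "\<lambda>u. c u - d u"]) blast
qed

text \<open>Comparing coefficients, each index in \<open>K\<close> costs \<open>d\<close> scalar
  congruences in the \<open>card U\<close> unknowns.\<close>

lemma exists_poly_mod_solution:
  fixes p :: int and q :: "'k \<Rightarrow> 'u \<Rightarrow> int poly"
  assumes p: "p > 1" and U: "finite U" and K: "finite K" and less: "card K * d < card U"
    and deg: "\<And>k u. k \<in> K \<Longrightarrow> u \<in> U \<Longrightarrow> degree (q k u) < d"
  shows "\<exists>c. (\<exists>u\<in>U. \<not> p dvd c u) \<and> (\<forall>k\<in>K. [:p:] dvd (\<Sum>u\<in>U. smult (c u) (q k u)))"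
proof -
  obtain c where c: "\<exists>u\<in>U. \<not> p dvd c u"
      and eq: "\<forall>(k, i)\<in>K \<times> {..<d}. p dvd (\<Sum>u\<in>U. c u * coeff (q k u) i)"
    using exists_mod_solution[OF p U, of "K \<times> {..<d}" "\<lambda>(k, i) u. coeff (q k u) i"] K less
    by (auto simp: card_cartesian_product split_def)
  have "[:p:] dvd (\<Sum>u\<in>U. smult (c u) (q k u))" if k: "k \<in> K" for k
    unfolding const_poly_dvd_iff
  proof
    fix i
    have "(\<Sum>u\<in>U. c u * coeff (q k u) i) = 0" if "i \<ge> d"
    proof (rule sum.neutral, safe)
      fix u assume "u \<in> U"
      then show "c u * coeff (q k u) i = 0"
        using deg[OF k, of u] that by (simp add: coeff_eq_0)
    qed
    then show "p dvd coeff (\<Sum>u\<in>U. smult (c u) (q k u)) i"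
      using eq k by (cases "i < d") (auto simp: coeff_sum)
  qed
  with c show ?thesis by blast
qed

section \<open>Orders of vanishing modulo a prime\<close>

lemma smult_sum_right: "smult c (\<Sum>i\<in>I. q i) = (\<Sum>i\<in>I. smult c (q i))"
  by (induction I rule: infinite_finite_induct) (simp_all add: smult_add_right)

text \<open>Membership in the ideal generated by \<open>[:-y, 1:] ^ v\<close> and
  \<open>[:p:]\<close>: the reduction modulo \<open>p\<close> is divisible by the
  \<open>v\<close>-th power of \<open>X - y\<close>.\<close>

definition vanishes_mod :: "int \<Rightarrow> int \<Rightarrow> nat \<Rightarrow> int poly \<Rightarrow> bool"
  where "vanishes_mod p y v q \<longleftrightarrow> (\<exists>h s. q = [:-y, 1:] ^ v * h + [:p:] * s)"

text \<open>For prime \<open>p\<close>, the exact multiplicity of \<open>y\<close> as a root of the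
  reduction. It is a relation because a polynomial divisible by \<open>p\<close> has no
  order.\<close>

definition order_mod :: "int \<Rightarrow> int \<Rightarrow> nat \<Rightarrow> int poly \<Rightarrow> bool"
  where "order_mod p y v q \<longleftrightarrow>
    (\<exists>h s. q = [:-y, 1:] ^ v * h + [:p:] * s \<and> \<not> p dvd poly h y)"

text \<open>The factor \<open>G\<close>, later the product of the \<open>f i\<close>, clears the
  denominators in the logarithmic derivative of a product of powers of the
  \<open>f i\<close>.\<close>

definition gderiv :: "int poly \<Rightarrow> int poly \<Rightarrow> int poly"
  where "gderiv G q = G * pderiv q"

text \<open>The conjugate of \<open>gderiv G\<close> by multiplication with a solution \<open>E\<close> of \<open>gderiv G E = s * E\<close>.\<close>
definition twisted :: "int poly \<Rightarrow> int poly \<Rightarrow> int poly \<Rightarrow> int poly"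
  where "twisted G s q = gderiv G q + s * q"

lemma order_mod_imp_vanishes: "order_mod p y v q \<Longrightarrow> vanishes_mod p y v q"
  by (auto simp: order_mod_def vanishes_mod_def)

lemma vanishes_mod_mono:
  assumes "vanishes_mod p y v q" "w \<le> v"
  shows "vanishes_mod p y w q"
proof -
  obtain h s where "q = [:-y, 1:] ^ v * h + [:p:] * s"
    using assms by (auto simp: vanishes_mod_def)
  moreover have "[:-y, 1:] ^ v = [:-y, 1:] ^ w * [:-y, 1:] ^ (v - w)"
    using assms by (simp flip: power_add)
  ultimately have "q = [:-y, 1:] ^ w * ([:-y, 1:] ^ (v - w) * h) + [:p:] * s"
    by (simp only: mult.assoc)
  then show ?thesis unfolding vanishes_mod_def by blast
qed

lemma vanishes_mod_add:
  assumes "vanishes_mod p y v q" "vanishes_mod p y v r"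
  shows "vanishes_mod p y v (q + r)"
proof -
  obtain h s h' s' where "q = [:-y, 1:] ^ v * h + [:p:] * s" "r = [:-y, 1:] ^ v * h' + [:p:] * s'"
    using assms by (auto simp: vanishes_mod_def)
  then have "q + r = [:-y, 1:] ^ v * (h + h') + [:p:] * (s + s')"
    by (simp only: ring_distribs ac_simps)
  then show ?thesis unfolding vanishes_mod_def by blast
qed

lemma vanishes_mod_mult:
  assumes "vanishes_mod p y v q"
  shows "vanishes_mod p y v (r * q)"
proof -
  obtain h s where "q = [:-y, 1:] ^ v * h + [:p:] * s"
    using assms by (auto simp: vanishes_mod_def)
  then have "r * q = [:-y, 1:] ^ v * (r * h) + [:p:] * (r * s)"
    by (simp only: ring_distribs ac_simps)
  then show ?thesis unfolding vanishes_mod_def by blast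
qed

lemma vanishes_mod_dvd:
  assumes "[:p:] dvd q"
  shows "vanishes_mod p y v q"
proof -
  obtain s where "q = [:p:] * s" using assms by blast
  then have "q = [:-y, 1:] ^ v * 0 + [:p:] * s" by (simp only: mult_zero_right add_0)
  then show ?thesis unfolding vanishes_mod_def by blast
qed

lemma vanishes_mod_sum:
  "(\<And>i. i \<in> I \<Longrightarrow> vanishes_mod p y v (q i)) \<Longrightarrow> vanishes_mod p y v (\<Sum>i\<in>I. q i)"
  by (induction I rule: infinite_finite_induct)
    (auto intro: vanishes_mod_add vanishes_mod_dvd)

lemma order_mod_add:
  assumes "order_mod p y v q" "vanishes_mod p y (Suc v) r"
  shows "order_mod p y v (q + r)"
proof -
  obtain h s h' s' where q: "q = [:-y, 1:] ^ v * h + [:p:] * s" "\<not> p dvd poly h y"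
    and "r = [:-y, 1:] ^ Suc v * h' + [:p:] * s'"
    using assms by (auto simp: vanishes_mod_def order_mod_def)
  then have "q + r = [:-y, 1:] ^ v * (h + [:-y, 1:] * h') + [:p:] * (s + s')"
    by (simp only: ring_distribs ac_simps power_Suc)
  moreover have "\<not> p dvd poly (h + [:-y, 1:] * h') y" using q by simp
  ultimately show ?thesis unfolding order_mod_def by blast
qed

lemma order_mod_0_iff: "order_mod p y 0 q \<longleftrightarrow> \<not> p dvd poly q y"
proof
  assume "order_mod p y 0 q"
  then show "\<not> p dvd poly q y"
    by (auto simp: order_mod_def dvd_add_left_iff)
next
  assume "\<not> p dvd poly q y"
  then show "order_mod p y 0 q"
    unfolding order_mod_def by (intro exI[of _ q] exI[of _ 0]) simp
qed

section \<open>The derivation and its iterates\<close>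

lemma gderiv_add: "gderiv G (q + r) = gderiv G q + gderiv G r"
  by (simp add: gderiv_def pderiv_add distrib_left)

lemma gderiv_0: "gderiv G 0 = 0"
  by (simp add: gderiv_def)

lemma gderiv_smult: "gderiv G (smult c q) = smult c (gderiv G q)"
  by (simp add: gderiv_def pderiv_smult)

lemma gderiv_pow_add: "(gderiv G ^^ k) (q + r) = (gderiv G ^^ k) q + (gderiv G ^^ k) r"
  by (induction k) (simp_all add: gderiv_add)

lemma gderiv_pow_smult: "(gderiv G ^^ k) (smult c q) = smult c ((gderiv G ^^ k) q)"
  by (induction k) (simp_all add: gderiv_smult)

lemma gderiv_pow_0: "(gderiv G ^^ k) 0 = 0"
  by (induction k) (simp_all add: gderiv_0)

lemma gderiv_pow_sum: "(gderiv G ^^ k) (\<Sum>i\<in>I. q i) = (\<Sum>i\<in>I. (gderiv G ^^ k) (q i))"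
  by (induction I rule: infinite_finite_induct) (simp_all add: gderiv_pow_add gderiv_pow_0)

lemma gderiv_pow_dvd: "[:p:] dvd q \<Longrightarrow> [:p:] dvd (gderiv G ^^ k) q"
  by (elim dvdE) (simp add: gderiv_pow_smult const_poly_dvd_iff)

lemma gderiv_pow_mult:
  assumes "gderiv G E = s * E"
  shows "(gderiv G ^^ k) (q * E) = (twisted G s ^^ k) q * E"
proof (induction k)
  case (Suc k)
  have "gderiv G (u * E) = twisted G s u * E" for u
  proof -
    have "gderiv G (u * E) = gderiv G u * E + u * gderiv G E"
      by (simp add: gderiv_def pderiv_mult algebra_simps)
    then show ?thesis using assms by (simp add: twisted_def algebra_simps)
  qed
  with Suc show ?case by simp
qed simp

text \<open>Each application costs at most \<open>m\<close> in degree, however large the degree of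
  the split-off factor \<open>E\<close>. This keeps the number of linear conditions small.\<close>

lemma degree_twisted_pow:
  assumes "degree G \<le> m" "degree s \<le> m"
  shows "degree ((twisted G s ^^ k) q) \<le> degree q + k * m"
proof (induction k)
  case (Suc k)
  have "degree (twisted G s u) \<le> degree u + m" for u
    unfolding twisted_def gderiv_def
  proof (rule degree_add_le)
    show "degree (G * pderiv u) \<le> degree u + m"
      using degree_mult_le[of G "pderiv u"] degree_pderiv[of u] assms by linarith
    show "degree (s * u) \<le> degree u + m"
      using degree_mult_le[of s u] assms by linarith
  qed
  from this[of "(twisted G s ^^ k) q"] Suc show ?case by simp
qed simp

text \<open>By the product rule, differentiating \<open>[:-y, 1:] ^ v * h\<close> loses at most one
  linear factor, while the constant \<open>p\<close> passes through.\<close>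

lemma gderiv_vanishes:
  assumes "vanishes_mod p y v q"
  shows "vanishes_mod p y (v - 1) (gderiv G q)"
proof (cases v)
  case 0
  then show ?thesis
    unfolding vanishes_mod_def by (intro exI[of _ "gderiv G q"] exI[of _ 0]) simp
next
  case (Suc w)
  obtain h s where "q = [:-y, 1:] ^ Suc w * h + [:p:] * s"
    using assms Suc by (auto simp: vanishes_mod_def)
  then have "gderiv G q = [:-y, 1:] ^ w *
      (smult (of_nat (Suc w)) (G * h) + [:-y, 1:] * G * pderiv h) + [:p:] * (G * pderiv s)"
    by (simp only: gderiv_def pderiv_add pderiv_mult pderiv_power_Suc)
      (simp add: algebra_simps pderiv_pCons smult_add_right)
  then show ?thesis unfolding vanishes_mod_def Suc by (metis diff_Suc_1)
qed

lemma gderiv_pow_vanishes: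
  "vanishes_mod p y v q \<Longrightarrow> vanishes_mod p y (v - k) ((gderiv G ^^ k) q)"
proof (induction k)
  case (Suc k)
  then show ?case using gderiv_vanishes[of p y "v - k" "(gderiv G ^^ k) q" G] by simp
qed simp

section \<open>Orders as valuations modulo a prime\<close>

context
  fixes p :: int
  assumes p: "prime p"
begin

lemma p_dvd_mult_iff: "p dvd a * b \<longleftrightarrow> p dvd a \<or> p dvd b"
  using p by (simp add: prime_dvd_mult_iff)

text \<open>Gauss's lemma: integer polynomials modulo \<open>p\<close> form an integral domain,
  which permits cancellation below.\<close>

lemma prime_elem_const: "prime_elem [:p:]"
  using p prime_elem_const_poly_iff by blast

lemma const_dvd_mult_iff: "[:p:] dvd q * r \<longleftrightarrow> [:p:] dvd q \<or> [:p:] dvd r"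
  using prime_elem_const by (simp add: prime_elem_dvd_mult_iff)

lemma const_not_dvd_linear_power: "\<not> [:p:] dvd [:-y, 1:] ^ v"
proof
  assume "[:p:] dvd [:-y, 1:] ^ v"
  then have "[:p:] dvd [:-y, 1:]" using prime_elem_const prime_elem_dvd_power by blast
  then have "p dvd coeff [:-y, 1:] 1" unfolding const_poly_dvd_iff by blast
  then show False using p by (simp add: not_prime_unit)
qed

text \<open>If \<open>w\<close> exceeded \<open>v\<close>, cancelling \<open>[:-y, 1:] ^ v\<close>
  modulo \<open>p\<close> from the two decompositions and evaluating at \<open>y\<close> would give
  \<open>p dvd poly h y\<close>. In particular the order is unique.\<close>

lemma order_mod_ge:
  assumes "order_mod p y v q" "vanishes_mod p y w q"
  shows "w \<le> v"
proof (rule ccontr)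
  assume "\<not> w \<le> v"
  then have "vanishes_mod p y (Suc v) q"
    using vanishes_mod_mono assms(2) by (metis not_less_eq_eq)
  then obtain h s h' s' where q: "q = [:-y, 1:] ^ v * h + [:p:] * s" "\<not> p dvd poly h y"
    and q': "q = [:-y, 1:] ^ Suc v * h' + [:p:] * s'"
    using assms(1) by (auto simp: vanishes_mod_def order_mod_def)
  have "[:-y, 1:] ^ v * (h - [:-y, 1:] * h') = [:p:] * (s' - s)"
  proof -
    have "[:-y, 1:] ^ v * h + [:p:] * s = [:-y, 1:] ^ v * ([:-y, 1:] * h') + [:p:] * s'"
      using q(1) q' by (simp only: power_Suc ac_simps)
    then show ?thesis unfolding right_diff_distrib by (simp only: diff_eq_eq eq_diff_eq add_ac)
  qed
  then have "[:p:] dvd h - [:-y, 1:] * h'"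
    using const_dvd_mult_iff const_not_dvd_linear_power by (metis dvd_triv_left)
  then obtain u where "h - [:-y, 1:] * h' = [:p:] * u" by blast
  then have "poly (h - [:-y, 1:] * h') y = poly ([:p:] * u) y" by (rule arg_cong)
  then show False using q(2) by simp
qed

lemma order_mod_not_dvd: "order_mod p y v q \<Longrightarrow> \<not> [:p:] dvd q"
  using order_mod_ge[of y v q "Suc v"] vanishes_mod_dvd[of p q y "Suc v"] by auto

lemma order_mod_mult:
  assumes "order_mod p y v q" "order_mod p y w r"
  shows "order_mod p y (v + w) (q * r)"
proof -
  obtain h s h' s' where q: "q = [:-y, 1:] ^ v * h + [:p:] * s" "\<not> p dvd poly h y"
    and r: "r = [:-y, 1:] ^ w * h' + [:p:] * s'" "\<not> p dvd poly h' y"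
    using assms by (auto simp: order_mod_def)
  have "q * r = [:-y, 1:] ^ (v + w) * (h * h') +
      [:p:] * (s * ([:-y, 1:] ^ w * h' + [:p:] * s') + [:-y, 1:] ^ v * h * s')"
    unfolding q(1) r(1) by (simp only: power_add ring_distribs ac_simps)
  moreover have "\<not> p dvd poly (h * h') y" using q r by (simp add: p_dvd_mult_iff)
  ultimately show ?thesis unfolding order_mod_def by blast
qed

lemma order_mod_1: "order_mod p y 0 1"
  using p by (auto simp: order_mod_0_iff dest: not_prime_unit)

lemma order_mod_power: "order_mod p y v q \<Longrightarrow> order_mod p y (k * v) (q ^ k)"
  by (induction k) (auto intro: order_mod_mult simp: order_mod_1)

lemma order_mod_prod:
  "(\<And>i. i \<in> I \<Longrightarrow> order_mod p y (v i) (q i)) \<Longrightarrow> order_mod p y (\<Sum>i\<in>I. v i) (\<Prod>i\<in>I. q i)"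
  by (induction I rule: infinite_finite_induct) (auto intro: order_mod_mult simp: order_mod_1)

lemma not_dvd_prod:
  "(\<And>i. i \<in> I \<Longrightarrow> \<not> [:p:] dvd q i) \<Longrightarrow> \<not> [:p:] dvd (\<Prod>i\<in>I. q i)"
proof (induction I rule: infinite_finite_induct)
  case (insert i I)
  then show ?case by (simp add: const_dvd_mult_iff)
qed (use order_mod_not_dvd[OF order_mod_1] in auto)

text \<open>Synthetic division by \<open>X - y\<close> is repeated while the remainder is divisible
  by \<open>p\<close>; such a remainder goes into \<open>[:p:] * s\<close>. Each round lowers the
  integer degree by one, which yields the degree bound.\<close>

lemma order_mod_exists:
  assumes "\<not> [:p:] dvd q"
  shows "\<exists>v h s. q = [:-y, 1:] ^ v * h + [:p:] * s \<and> \<not> p dvd poly h y \<and> v + degree h \<le> degree q"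
  using assms
proof (induction "degree q" arbitrary: q rule: less_induct)
  case less
  show ?case
  proof (cases "p dvd poly q y")
    case False
    then show ?thesis by (intro exI[of _ 0] exI[of _ q] exI[of _ 0]) simp
  next
    case True
    define r where "r = synthetic_div q y"
    have q: "q = [:-y, 1:] * r + [:poly q y:]"
      using synthetic_div_correct'[of y q] by (simp add: r_def)
    obtain c where c: "poly q y = p * c" using True by blast
    have c': "[:poly q y:] = [:p:] * [:c:]" by (simp add: c)
    have "degree q \<noteq> 0"
    proof
      assume "degree q = 0"
      then obtain a where "q = [:a:]" by (rule degree_eq_zeroE)
      with True less.prems show False by simp
    qed
    moreover have "degree r = degree q - 1" by (simp add: r_def degree_synthetic_div)
    ultimately have deg: "degree r < degree q" "Suc (degree r) = degree q" by auto
    have "\<not> [:p:] dvd r" using less.prems q c' by (metis dvd_add dvd_mult dvd_triv_left)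
    from less.hyps[OF deg(1) this] obtain v h s
      where r: "r = [:-y, 1:] ^ v * h + [:p:] * s" and h: "\<not> p dvd poly h y" "v + degree h \<le> degree r"
      by blast
    have "q = [:-y, 1:] ^ Suc v * h + [:p:] * ([:-y, 1:] * s + [:c:])"
      by (subst q, subst r, subst c') (simp only: ring_distribs ac_simps power_Suc)
    with h deg(2) show ?thesis by (intro exI[of _ "Suc v"] exI) auto
  qed
qed

lemma order_mod_obtain:
  assumes "\<not> [:p:] dvd q"
  obtains v where "order_mod p y v q" "v \<le> degree q"
  using order_mod_exists[OF assms, of y] unfolding order_mod_def by force

text \<open>Induction on \<open>M\<close>: the full power of \<open>X - x\<close> at one point is
  split off. Distinct elements of \<open>{0..<p}\<close> are incongruent, so the orders of the
  cofactor at the other points are those of \<open>q\<close>.\<close>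

lemma card_mult_le_degree:
  assumes "finite M" "M \<subseteq> {0..<p}" "\<not> [:p:] dvd q"
    and "\<And>x w. x \<in> M \<Longrightarrow> order_mod p x w q \<Longrightarrow> D \<le> w"
  shows "card M * D \<le> degree q"
  using assms
proof (induction M arbitrary: q rule: finite_induct)
  case (insert x M)
  obtain v h s where q: "q = [:-x, 1:] ^ v * h + [:p:] * s" "\<not> p dvd poly h x"
    and deg: "v + degree h \<le> degree q"
    using order_mod_exists[OF insert.prems(2), of x] by blast
  have "order_mod p x v q" using q unfolding order_mod_def by blast
  then have "D \<le> v" using insert.prems(3) by blast
  have "card M * D \<le> degree h"
  proof (rule insert.IH)
    show "M \<subseteq> {0..<p}" using insert.prems by auto
    show "\<not> [:p:] dvd h"
      using q insert.prems(2) by (metis dvd_add dvd_mult dvd_triv_left)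
    fix z w assume z: "z \<in> M" "order_mod p z w h"
    have "\<not> p dvd z - x"
    proof
      assume "p dvd z - x"
      then have "z mod p = x mod p" by (simp add: mod_eq_dvd_iff)
      moreover have "z \<in> {0..<p}" "x \<in> {0..<p}" using z insert.prems by auto
      ultimately show False using z insert.hyps by simp
    qed
    then have "order_mod p z (v * 0) ([:-x, 1:] ^ v)"
      by (intro order_mod_power) (simp add: order_mod_0_iff)
    from order_mod_mult[OF this z(2)] have "order_mod p z w ([:-x, 1:] ^ v * h)" by simp
    then have "order_mod p z w q" unfolding q
      by (rule order_mod_add) (intro vanishes_mod_dvd dvd_triv_left)
    then show "D \<le> w" using insert.prems z by blast
  qed
  with \<open>D \<le> v\<close> deg insert.hyps show ?case by simp
qed simp

text \<open>After one linear factor is lost, the cofactor takes at \<open>y\<close> the value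
  \<open>Suc w\<close> times \<open>G\<close> times \<open>h\<close>, and \<open>Suc w\<close> is
  prime to \<open>p\<close> because it lies below \<open>p\<close>.\<close>

lemma gderiv_order:
  assumes "order_mod p y (Suc w) q" "int (Suc w) < p" "\<not> p dvd poly G y"
  shows "order_mod p y w (gderiv G q)"
proof -
  obtain h s where q: "q = [:-y, 1:] ^ Suc w * h + [:p:] * s" and h: "\<not> p dvd poly h y"
    using assms by (auto simp: order_mod_def)
  let ?h = "smult (of_nat (Suc w)) (G * h) + [:-y, 1:] * G * pderiv h"
  have "gderiv G q = [:-y, 1:] ^ w * ?h + [:p:] * (G * pderiv s)"
    unfolding q by (simp only: gderiv_def pderiv_add pderiv_mult pderiv_power_Suc)
      (simp add: algebra_simps pderiv_pCons smult_add_right)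
  moreover have "\<not> p dvd int (Suc w)" using assms(2) zdvd_not_zless by force
  then have "\<not> p dvd poly ?h y"
    using h assms(3) by (simp add: p_dvd_mult_iff del: of_nat_Suc)
  ultimately show ?thesis unfolding order_mod_def by blast
qed

lemma gderiv_pow_order:
  assumes "order_mod p y v q" "int v < p" "\<not> p dvd poly G y" "k \<le> v"
  shows "order_mod p y (v - k) ((gderiv G ^^ k) q)"
  using assms(4)
proof (induction k)
  case 0
  then show ?case using assms by simp
next
  case (Suc k)
  then have "order_mod p y (Suc (v - Suc k)) ((gderiv G ^^ k) q)" by (simp add: Suc_diff_Suc)
  from gderiv_order[OF this _ assms(3)] Suc.prems assms(2) show ?case by simp
qed

text \<open>The \<open>v\<close>-th iterate lowers the order exactly to 0, so its value at
  \<open>y\<close> is a unit modulo \<open>p\<close>; hence \<open>v\<close> is not among the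
  \<open>k < D\<close>.\<close>

lemma order_mod_ge_gderiv:
  assumes "order_mod p y v q" "int v < p" "\<not> p dvd poly G y"
    and "\<And>k. k < D \<Longrightarrow> p dvd poly ((gderiv G ^^ k) q) y"
  shows "D \<le> v"
proof (rule ccontr)
  assume "\<not> D \<le> v"
  with assms(4) have "p dvd poly ((gderiv G ^^ v) q) y" by simp
  moreover have "order_mod p y 0 ((gderiv G ^^ v) q)"
    using gderiv_pow_order[OF assms(1-3) order_refl] by simp
  ultimately show False by (simp add: order_mod_0_iff)
qed

lemma exists_nonroot:
  assumes "\<not> [:p:] dvd q" "int (degree q) < p"
  shows "\<exists>y. \<not> p dvd poly q y"
proof (rule ccontr)
  assume *: "\<not> ?thesis"
  have "card {0..<p} * 1 \<le> degree q"
  proof (rule card_mult_le_degree[OF _ _ assms(1)])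
    fix x w assume "order_mod p x w q"
    then show "1 \<le> w" using * order_mod_0_iff[of p x q] by (cases w) auto
  qed auto
  with assms(2) show False by simp
qed

section \<open>Independence of exponentials and the Stepanov bound\<close>

text \<open>An operator of order below \<open>r\<close> cannot annihilate an \<open>r\<close>-dimensional space: that space
  contains a polynomial of order \<open>v \<ge> k\<close> at a point where the leading coefficient \<open>c k\<close>
  and \<open>G\<close> do not vanish, and there the term of index \<open>k\<close> has the strictly smallest order.\<close>
lemma operator_not_annihilating:
  fixes g :: "'b \<Rightarrow> int poly" and c :: "nat \<Rightarrow> int poly"
  assumes S: "finite S" "card S = r"
    and indep: "\<And>l. [:p:] dvd (\<Sum>b\<in>S. smult (l b) (g b)) \<Longrightarrow> \<forall>b\<in>S. p dvd l b"
    and deg: "\<And>b. b \<in> S \<Longrightarrow> int (degree (g b)) < p"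
    and c: "\<exists>j<r. \<not> [:p:] dvd c j"
    and degc: "\<And>j. j < r \<Longrightarrow> int (degree (c j) + degree G) < p"
    and G: "\<not> [:p:] dvd G"
  shows "\<exists>b\<in>S. \<not> [:p:] dvd (\<Sum>j<r. c j * (gderiv G ^^ j) (g b))"
proof (rule ccontr)
  assume *: "\<not> ?thesis"
  define J where "J = {j. j < r \<and> \<not> [:p:] dvd c j}"
  define k where "k = Max J"
  have J: "finite J" "J \<noteq> {}" using c by (auto simp: J_def)
  have k: "k < r" "\<not> [:p:] dvd c k" using Max_in[OF J] by (auto simp: k_def J_def)
  have above: "[:p:] dvd c j" if "k < j" "j < r" for j
    using Max_ge[OF J(1), of j] that unfolding k_def by (fastforce simp: J_def)
  have "\<not> [:p:] dvd c k * G" using k G by (simp add: const_dvd_mult_iff)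
  moreover have "int (degree (c k * G)) < p"
    using degc[OF k(1)] degree_mult_le[of "c k" G] by linarith
  ultimately obtain y where "\<not> p dvd poly (c k * G) y" using exists_nonroot by blast
  then have y: "\<not> p dvd poly (c k) y" "\<not> p dvd poly G y" by (auto simp: p_dvd_mult_iff)
  \<comment> \<open>There are \<open>k < r\<close> conditions on \<open>r\<close> unknowns, so some
    nontrivial combination has its iterates of index below \<open>k\<close> vanishing at
    \<open>y\<close>.\<close>
  obtain l where l: "\<exists>b\<in>S. \<not> p dvd l b"
    and van: "\<forall>i\<in>{..<k}. p dvd (\<Sum>b\<in>S. l b * poly ((gderiv G ^^ i) (g b)) y)"
    using exists_mod_solution[of p S "{..<k}" "\<lambda>i b. poly ((gderiv G ^^ i) (g b)) y"]
      S k p prime_gt_1_int by auto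
  define q where "q = (\<Sum>b\<in>S. smult (l b) (g b))"
  have pow_q: "(gderiv G ^^ i) q = (\<Sum>b\<in>S. smult (l b) ((gderiv G ^^ i) (g b)))" for i
    by (simp add: q_def gderiv_pow_sum gderiv_pow_smult)
  have "\<not> [:p:] dvd q" using indep l unfolding q_def by blast
  then obtain v where v: "order_mod p y v q" "v \<le> degree q" by (rule order_mod_obtain)
  \<comment> \<open>The order is at most the degree, hence below \<open>p\<close>, so every
    application of \<open>gderiv G\<close> lowers a positive order at \<open>y\<close> by exactly
    one.\<close>
  have "degree q \<le> nat (p - 1)"
    unfolding q_def using deg S by (intro degree_sum_le) (force intro: order_trans[OF degree_smult_le])+
  with v p have vp: "int v < p" using prime_gt_1_int[of p] by linarith
  have "k \<le> v"
  proof (rule order_mod_ge_gderiv[OF v(1) vp y(2)])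
    fix i assume "i < k"
    then show "p dvd poly ((gderiv G ^^ i) q) y" using van by (simp add: pow_q poly_sum)
  qed
  have "order_mod p y (0 + (v - k)) (c k * (gderiv G ^^ k) q)"
    by (intro order_mod_mult gderiv_pow_order v vp y \<open>k \<le> v\<close>) (simp add: order_mod_0_iff y)
  \<comment> \<open>Terms with \<open>j < k\<close> have order at least \<open>v - j\<close>, which
    exceeds \<open>v - k\<close>; those with \<open>j > k\<close> vanish modulo \<open>p\<close> by
    maximality of \<open>k\<close>.\<close>
  moreover have "vanishes_mod p y (Suc (v - k)) (\<Sum>j\<in>{..<r} - {k}. c j * (gderiv G ^^ j) q)"
  proof (rule vanishes_mod_sum)
    fix j assume "j \<in> {..<r} - {k}"
    then consider "j < k" | "k < j" "j < r" by force
    then show "vanishes_mod p y (Suc (v - k)) (c j * (gderiv G ^^ j) q)"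
    proof cases
      case 1
      have "vanishes_mod p y (v - j) ((gderiv G ^^ j) q)"
        by (intro gderiv_pow_vanishes order_mod_imp_vanishes v)
      then show ?thesis using 1 \<open>k \<le> v\<close> by (intro vanishes_mod_mult) (erule vanishes_mod_mono, simp)
    next
      case 2
      then show ?thesis by (intro vanishes_mod_dvd dvd_mult2 above)
    qed
  qed
  ultimately have "order_mod p y (v - k)
      (c k * (gderiv G ^^ k) q + (\<Sum>j\<in>{..<r} - {k}. c j * (gderiv G ^^ j) q))"
    by (simp add: order_mod_add)
  also have "\<dots> = (\<Sum>j<r. c j * (gderiv G ^^ j) q)"
    using k(1) by (simp add: sum.remove[of "{..<r}" k])
  also have "\<dots> = (\<Sum>b\<in>S. smult (l b) (\<Sum>j<r. c j * (gderiv G ^^ j) (g b)))"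
    unfolding pow_q sum_distrib_left by (subst sum.swap) (simp add: smult_sum_right)
  finally have "\<not> [:p:] dvd (\<Sum>b\<in>S. smult (l b) (\<Sum>j<r. c j * (gderiv G ^^ j) (g b)))"
    by (rule order_mod_not_dvd)
  moreover have "[:p:] dvd (\<Sum>b\<in>S. smult (l b) (\<Sum>j<r. c j * (gderiv G ^^ j) (g b)))"
  proof (rule dvd_sum)
    fix b assume "b \<in> S"
    then show "[:p:] dvd smult (l b) (\<Sum>j<r. c j * (gderiv G ^^ j) (g b))"
      using * by (intro dvd_smult) blast
  qed
  ultimately show False by contradiction
qed

end

lemma const_dvd_smult_iff:
  assumes "prime (p :: int)"
  shows "[:p:] dvd smult c q \<longleftrightarrow> p dvd c \<or> [:p:] dvd q"
  using const_dvd_mult_iff[OF assms, of "[:c:]" q] by simp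

lemma const_dvd_poly: "[:p:] dvd q \<Longrightarrow> p dvd poly q x"
  by (elim dvdE) simp

lemma monom_mult_eq: "monom c n * q = smult c (monom 1 n * (q :: int poly))"
  by (simp only: mult_smult_left[symmetric] smult_monom mult_1_right)

lemma sum_degree_less:
  assumes "finite I" "\<And>i. i \<in> I \<Longrightarrow> degree (q i) < d" "0 < d"
  shows "degree (\<Sum>i\<in>I. q i) < d"
proof -
  have "degree (\<Sum>i\<in>I. q i) \<le> d - 1"
    using assms by (intro degree_sum_le) force+
  with assms(3) show ?thesis by simp
qed

lemma degree_mult_less:
  fixes q r :: "int poly"
  assumes "degree q < a" "degree r \<le> b"
  shows "degree (q * r) < a + b"
  using degree_mult_le[of q r] assms by linarith

text \<open>The functions \<open>E b\<close> are solutions of first-order equations whose quotients are far, in the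
  sense of \<open>separated\<close>, from being rational functions of degree below \<open>t\<close> modulo \<open>p\<close>.\<close>
locale exponential_system =
  fixes p :: int and G :: "int poly" and m t :: nat
    and S :: "'b set" and E s :: "'b \<Rightarrow> int poly"
  assumes prime: "prime p"
    and finite: "finite S"
    and G_nonzero: "\<not> [:p:] dvd G" and degree_G: "degree G \<le> m"
    and E_nonzero: "b \<in> S \<Longrightarrow> \<not> [:p:] dvd E b"
    and gderiv_E: "b \<in> S \<Longrightarrow> gderiv G (E b) = s b * E b"
    and degree_s: "b \<in> S \<Longrightarrow> degree (s b) \<le> m"
    and separated: "\<lbrakk>b \<in> S; b' \<in> S; b \<noteq> b'; [:p:] dvd R * E b + R' * E b';
      degree R < t; degree R' < t\<rbrakk> \<Longrightarrow> [:p:] dvd R"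
begin

lemma independent:
  assumes t: "(card S + 1) * (A + card S * m) \<le> t" "int t \<le> p"
    and deg_E: "\<And>b. b \<in> S \<Longrightarrow> int (degree (E b) + A) \<le> p"
    and deg_P: "\<And>b. b \<in> S \<Longrightarrow> degree (P b) < A"
    and rel: "[:p:] dvd (\<Sum>b\<in>S. P b * E b)"
  shows "\<forall>b\<in>S. [:p:] dvd P b"
  using deg_P rel
proof (induction "card {b \<in> S. \<not> [:p:] dvd P b}" arbitrary: P rule: less_induct)
  case less
  define T where "T = {b \<in> S. \<not> [:p:] dvd P b}"
  have T: "T \<subseteq> S" "finite T" using finite by (auto simp: T_def)
  show ?case
  proof (rule ccontr)
    assume "\<not> ?case"
    then obtain b1 where b1: "b1 \<in> T" by (auto simp: T_def)
    have "[:p:] dvd (\<Sum>b\<in>S - T. P b * E b)"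
      by (rule dvd_sum) (auto simp: T_def)
    moreover have "(\<Sum>b\<in>S. P b * E b) = (\<Sum>b\<in>S - T. P b * E b) + (\<Sum>b\<in>T. P b * E b)"
      using sum.subset_diff[OF T(1) finite] .
    ultimately have rel_T: "[:p:] dvd (\<Sum>b\<in>T. P b * E b)"
      using less.prems(2) dvd_add_right_iff[of "[:p:]" "\<Sum>b\<in>S - T. P b * E b"] by simp
    \<comment> \<open>A single nonzero term is not a relation, so a second index \<open>b0\<close>
      exists.\<close>
    have "\<not> [:p:] dvd P b1 * E b1"
      using b1 E_nonzero by (simp add: const_dvd_mult_iff[OF prime] T_def)
    with rel_T b1 have "T \<noteq> {b1}" by auto
    with b1 obtain b0 where b0: "b0 \<in> T" "b0 \<noteq> b1" by blast
    define S1 where "S1 = T - {b1}"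
    define r where "r = card S1"
    define N where "N = card S"
    \<comment> \<open>\<open>L\<close> bounds the degrees of the operator coefficients. It is chosen
      so that their \<open>r * L\<close> unknowns outnumber the
      \<open>(r - 1) * (L + (A + r * m))\<close> conditions, using \<open>r \<le> N\<close>.\<close>
    define L where "L = N * (A + N * m)"
    have S1: "finite S1" "b0 \<in> S1" "S1 \<subset> T" "S1 \<subseteq> S" using T b0 b1 by (auto simp: S1_def)
    have r: "0 < r" "r \<le> N" using S1 finite by (auto simp: r_def N_def card_gt_0_iff intro: card_mono)
    have A: "0 < A" using less.prems(1)[of b0] b0 T by auto
    have Lt: "L + A + N * m \<le> t" using t(1) by (simp add: L_def N_def)
    have "0 < L" using A r by (simp add: L_def)
    \<comment> \<open>A relation supported on \<open>S1\<close> has fewer nonzero terms than the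
      given one, so the induction hypothesis applies to it.\<close>
    have indep: "\<forall>b\<in>S1. p dvd l b" if "[:p:] dvd (\<Sum>b\<in>S1. smult (l b) (P b * E b))" for l
    proof -
      define P' where "P' b = (if b \<in> S1 then smult (l b) (P b) else 0)" for b
      have "\<forall>b\<in>S. [:p:] dvd P' b"
      proof (rule less.hyps)
        have "{b \<in> S. \<not> [:p:] dvd P' b} \<subseteq> S1" by (auto simp: P'_def)
        then have "{b \<in> S. \<not> [:p:] dvd P' b} \<subset> T" using S1 by blast
        then show "card {b \<in> S. \<not> [:p:] dvd P' b} < card {b \<in> S. \<not> [:p:] dvd P b}"
          unfolding T_def[symmetric] by (rule psubset_card_mono[OF T(2)])
        show "degree (P' b) < A" if "b \<in> S" for b
          using less.prems(1)[OF that] A degree_smult_le[of "l b" "P b"] by (simp add: P'_def)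
        have "(\<Sum>b\<in>S. P' b * E b) = (\<Sum>b\<in>S1. P' b * E b)"
          using S1 finite by (intro sum.mono_neutral_right) (auto simp: P'_def)
        also have "\<dots> = (\<Sum>b\<in>S1. smult (l b) (P b * E b))"
          by (rule sum.cong) (auto simp: P'_def)
        finally show "[:p:] dvd (\<Sum>b\<in>S. P' b * E b)" using that by simp
      qed
      then have "[:p:] dvd smult (l b) (P b)" if "b \<in> S1" for b
        using that S1 by (auto simp: P'_def dest: bspec[of _ _ b])
      moreover have "\<not> [:p:] dvd P b" if "b \<in> S1" for b using that S1 by (auto simp: T_def)
      ultimately show ?thesis by (auto simp: const_dvd_smult_iff[OF prime])
    qed
    define Q where "Q j b = (twisted G (s b) ^^ j) (P b)" for j b
    have deg_Q: "degree (Q j b) < A + r * m" if "b \<in> S" "j < r" for j b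
    proof -
      have "degree (Q j b) \<le> degree (P b) + j * m"
        unfolding Q_def by (rule degree_twisted_pow[OF degree_G degree_s[OF that(1)]])
      moreover have "j * m \<le> r * m" using that by simp
      ultimately show ?thesis using less.prems(1)[OF that(1)] by linarith
    qed
    have card_less: "card (S1 - {b0}) * (L + (A + r * m)) < card ({..<r} \<times> {..<L})"
    proof -
      obtain r' where r': "r = Suc r'" using r by (cases r) auto
      have "r' * (A + r * m) \<le> r' * (A + N * m)" using r by simp
      also have "\<dots> < N * (A + N * m)" using r r' A by simp
      finally have "r' * (A + r * m) < L" by (simp add: L_def)
      moreover have "card (S1 - {b0}) = r'" using S1 r' by (simp add: r_def)
      ultimately show ?thesis using r' by (simp add: add_mult_distrib2 card_cartesian_product)
    qed
    have deg_u: "degree (monom 1 (snd u) * Q (fst u) b) < L + (A + r * m)"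
      if "b \<in> S1 - {b0}" "u \<in> {..<r} \<times> {..<L}" for b u
    proof (rule degree_mult_less)
      show "degree (monom (1 :: int) (snd u)) < L" using that(2) by (auto simp: degree_monom_eq)
      show "degree (Q (fst u) b) \<le> A + r * m" using that S1 deg_Q[of b "fst u"] by force
    qed
    \<comment> \<open>The unknown \<open>l (j, i)\<close> is the coefficient of \<open>X ^ i\<close>
      in \<open>c j\<close>; the conditions ask the operator to annihilate every term in
      \<open>S1\<close> except that of \<open>b0\<close>.\<close>
    have "\<exists>l. (\<exists>u\<in>{..<r} \<times> {..<L}. \<not> p dvd l u) \<and> (\<forall>b\<in>S1 - {b0}. [:p:] dvd
        (\<Sum>u\<in>{..<r} \<times> {..<L}. smult (l u) (monom 1 (snd u) * Q (fst u) b)))"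
      using S1(1) by (intro exists_poly_mod_solution[OF prime_gt_1_int[OF prime] _ _ card_less deg_u]) auto
    then obtain l where l: "\<exists>u\<in>{..<r} \<times> {..<L}. \<not> p dvd l u"
      and l0: "\<forall>b\<in>S1 - {b0}. [:p:] dvd
        (\<Sum>u\<in>{..<r} \<times> {..<L}. smult (l u) (monom 1 (snd u) * Q (fst u) b))"
      by blast
    define c where "c j = (\<Sum>i<L. monom (l (j, i)) i)" for j
    define R where "R b = (\<Sum>j<r. c j * Q j b)" for b
    have R_eq: "R b = (\<Sum>u\<in>{..<r} \<times> {..<L}. smult (l u) (monom 1 (snd u) * Q (fst u) b))" for b
    proof -
      have "R b = (\<Sum>j<r. \<Sum>i<L. smult (l (j, i)) (monom 1 i * Q j b))"
        by (simp add: R_def c_def sum_distrib_right monom_mult_eq[of "l _"])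
      then show ?thesis by (simp add: sum.cartesian_product split_def)
    qed
    have coeff_c: "coeff (c j) i = l (j, i)" if "i < L" for i j
      using that by (simp add: c_def coeff_sum coeff_monom)
    have deg_c: "degree (c j) < L" for j
      unfolding c_def using \<open>0 < L\<close>
      by (intro sum_degree_less) (auto intro: le_less_trans[OF degree_monom_le])
    have deg_R: "degree (R b) < t" if "b \<in> S" for b
    proof -
      have "degree (c j * Q j b) < L + (A + r * m)" if "j < r" for j
        using deg_c deg_Q[OF \<open>b \<in> S\<close> that] by (intro degree_mult_less) auto
      then have "degree (R b) < L + (A + r * m)"
        unfolding R_def using \<open>0 < L\<close> by (intro sum_degree_less) auto
      moreover have "r * m \<le> N * m" using r by simp
      ultimately show ?thesis using Lt by linarith
    qed
    have op: "(\<Sum>j<r. c j * (gderiv G ^^ j) (P b * E b)) = R b * E b" if "b \<in> S" for b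
      unfolding R_def Q_def sum_distrib_right
      by (simp add: gderiv_pow_mult[OF gderiv_E[OF that]] mult.assoc)
    \<comment> \<open>The terms over \<open>S1\<close> are independent, so the operator does not
      annihilate them all; the surviving one must be \<open>b0\<close>.\<close>
    have "\<exists>b\<in>S1. \<not> [:p:] dvd (\<Sum>j<r. c j * (gderiv G ^^ j) (P b * E b))"
    proof (rule operator_not_annihilating[OF prime S1(1) r_def[symmetric] indep _ _ _ G_nonzero])
      show "int (degree (P b * E b)) < p" if "b \<in> S1" for b
        using degree_mult_le[of "P b" "E b"] less.prems(1)[of b] deg_E[of b] that S1 by force
      obtain j i where "j < r" "i < L" "\<not> p dvd l (j, i)" using l by auto
      then show "\<exists>j<r. \<not> [:p:] dvd c j"
        unfolding const_poly_dvd_iff by (metis coeff_c)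
      show "int (degree (c j) + degree G) < p" for j
      proof -
        have "m \<le> N * m" using r by simp
        then show ?thesis using deg_c[of j] degree_G Lt t(2) by linarith
      qed
    qed
    then obtain b where b: "b \<in> S1" "\<not> [:p:] dvd R b * E b" using op S1(4) by (metis subsetD)
    have R_zero: "[:p:] dvd R b" if "b \<in> S1 - {b0}" for b using l0 that R_eq by simp
    have "b = b0" using R_zero[of b] b by (metis DiffI dvd_mult2 singletonD)
    \<comment> \<open>Applying the operator to the whole relation leaves only the terms of
      \<open>b0\<close> and \<open>b1\<close>, to which \<open>separated\<close> applies.\<close>
    have "(\<Sum>b\<in>T. R b * E b) = (\<Sum>b\<in>T. \<Sum>j<r. c j * (gderiv G ^^ j) (P b * E b))"
      using op T by (intro sum.cong) auto
    also have "\<dots> = (\<Sum>j<r. c j * (gderiv G ^^ j) (\<Sum>b\<in>T. P b * E b))"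
      unfolding gderiv_pow_sum sum_distrib_left by (rule sum.swap)
    finally have "[:p:] dvd (\<Sum>b\<in>T. R b * E b)"
      using rel_T by (auto intro!: dvd_sum dvd_mult gderiv_pow_dvd)
    also have "(\<Sum>b\<in>T. R b * E b) = R b1 * E b1 + (R b0 * E b0 + (\<Sum>b\<in>S1 - {b0}. R b * E b))"
      using sum.remove[OF T(2) b1, of "\<lambda>b. R b * E b"] sum.remove[OF S1(1,2), of "\<lambda>b. R b * E b"]
      by (simp add: S1_def)
    also have "\<dots> = (R b0 * E b0 + R b1 * E b1) + (\<Sum>b\<in>S1 - {b0}. R b * E b)" by simp
    finally have "[:p:] dvd R b0 * E b0 + R b1 * E b1"
      using R_zero by (subst (asm) dvd_add_left_iff) (auto intro!: dvd_sum dvd_mult2)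
    then have "[:p:] dvd R b0"
      using separated[of b0 b1] b0 b1 T deg_R by blast
    with b \<open>b = b0\<close> show False by simp
  qed
qed

text \<open>On \<open>M\<close> each \<open>E b\<close> is the constant \<open>e b\<close> modulo
  \<open>p\<close>. So one polynomial congruence of degree below \<open>A + D * m\<close> makes the
  \<open>k\<close>-th iterate vanish on all of \<open>M\<close>, whatever the size of
  \<open>M\<close>. The \<open>A * card S\<close> unknown coefficients outnumber the conditions for
  \<open>k < D\<close>.\<close>

lemma card_mult_le:
  assumes t: "(card S + 1) * (A + card S * m) \<le> t" "int t \<le> p"
    and deg_E: "\<And>b. b \<in> S \<Longrightarrow> degree (E b) + A \<le> H" and H: "int H \<le> p"
    and M: "M \<subseteq> {0..<p}" and G_M: "\<And>x. x \<in> M \<Longrightarrow> \<not> p dvd poly G x"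
    and E_M: "\<And>x b. x \<in> M \<Longrightarrow> b \<in> S \<Longrightarrow> p dvd poly (E b) x - e b"
    and D: "D * (A + D * m) < A * card S"
  shows "card M * D \<le> H"
proof -
  have A: "0 < A" "S \<noteq> {}" using D by (auto intro!: Nat.gr0I)
  \<comment> \<open>For \<open>u = (a, b)\<close>, \<open>Q k u * E b\<close> is the
    \<open>k\<close>-th iterate applied to \<open>X ^ a * E b\<close>.\<close>
  define Q where "Q k u = (twisted G (s (snd u)) ^^ k) (monom 1 (fst u))" for k and u :: "nat \<times> 'b"
  have card_less: "card {..<D} * (A + D * m) < card ({..<A} \<times> S)"
    using D by (simp add: card_cartesian_product)
  have "degree (smult (e b) (Q k (a, b))) < A + D * m" if "k < D" "a < A" "b \<in> S" for k a b
  proof -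
    have "degree (Q k (a, b)) \<le> degree (monom (1 :: int) a) + k * m"
      unfolding Q_def using degree_G degree_s[OF that(3)] by (simp add: degree_twisted_pow)
    moreover have "k * m \<le> D * m" using that by simp
    ultimately show ?thesis
      using degree_smult_le[of "e b" "Q k (a, b)"] degree_monom_le[of "1 :: int" a] that by linarith
  qed
  then have deg_u: "degree (smult (e (snd u)) (Q k u)) < A + D * m"
    if "k \<in> {..<D}" "u \<in> {..<A} \<times> S" for k u
    using that by (cases u) simp
  have "\<exists>l. (\<exists>u\<in>{..<A} \<times> S. \<not> p dvd l u) \<and>
      (\<forall>k\<in>{..<D}. [:p:] dvd (\<Sum>u\<in>{..<A} \<times> S. smult (l u) (smult (e (snd u)) (Q k u))))"
    using finite
    by (intro exists_poly_mod_solution[OF prime_gt_1_int[OF prime] _ _ card_less deg_u]) auto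
  then obtain l where l: "\<exists>u\<in>{..<A} \<times> S. \<not> p dvd l u"
    and l0: "\<forall>k\<in>{..<D}. [:p:] dvd (\<Sum>u\<in>{..<A} \<times> S. smult (l u) (smult (e (snd u)) (Q k u)))"
    by blast
  define P where "P b = (\<Sum>a<A. monom (l (a, b)) a)" for b
  define \<Psi> where "\<Psi> = (\<Sum>b\<in>S. P b * E b)"
  have deg_P: "degree (P b) < A" for b
    unfolding P_def using A by (intro sum_degree_less) (auto intro: le_less_trans[OF degree_monom_le])
  have coeff_P: "coeff (P b) a = l (a, b)" if "a < A" for a b
    using that by (simp add: P_def coeff_sum coeff_monom)
  have \<Psi>_nonzero: "\<not> [:p:] dvd \<Psi>"
  proof
    assume "[:p:] dvd \<Psi>"
    then have "\<forall>b\<in>S. [:p:] dvd P b"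
      using independent[OF t, of P] deg_E H deg_P unfolding \<Psi>_def by force
    moreover obtain a b where "a < A" "b \<in> S" "\<not> p dvd l (a, b)" using l by auto
    ultimately show False unfolding const_poly_dvd_iff by (metis coeff_P)
  qed
  have "0 < H" using A deg_E by (metis add_is_0 bot_nat_0.not_eq_extremum ex_in_conv le_zero_eq)
  have deg_\<Psi>: "degree \<Psi> < H"
    unfolding \<Psi>_def
  proof (rule sum_degree_less[OF finite _ \<open>0 < H\<close>])
    fix b assume "b \<in> S"
    then show "degree (P b * E b) < H"
      using degree_mult_le[of "P b" "E b"] deg_P[of b] deg_E[of b] by linarith
  qed
  have \<Psi>_eq: "\<Psi> = (\<Sum>u\<in>{..<A} \<times> S. smult (l u) (monom 1 (fst u) * E (snd u)))"
  proof -
    have "\<Psi> = (\<Sum>b\<in>S. \<Sum>a<A. smult (l (a, b)) (monom 1 a * E b))"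
      by (simp add: \<Psi>_def P_def sum_distrib_right monom_mult_eq[of "l _"])
    also have "\<dots> = (\<Sum>a<A. \<Sum>b\<in>S. smult (l (a, b)) (monom 1 a * E b))" by (rule sum.swap)
    finally show ?thesis by (simp add: sum.cartesian_product split_def)
  qed
  have vanish: "p dvd poly ((gderiv G ^^ k) \<Psi>) x" if "x \<in> M" "k < D" for x k
  proof -
    \<comment> \<open>The \<open>k\<close>-th iterate of \<open>\<Psi>\<close> with each
      \<open>E b\<close> replaced by \<open>e b\<close> and thus free of large powers.\<close>
    let ?q = "\<Sum>u\<in>{..<A} \<times> S. smult (l u) (smult (e (snd u)) (Q k u))"
    have "(gderiv G ^^ k) \<Psi> = (\<Sum>u\<in>{..<A} \<times> S. smult (l u) (Q k u * E (snd u)))"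
      unfolding \<Psi>_eq gderiv_pow_sum gderiv_pow_smult Q_def
      by (intro sum.cong refl arg_cong[where f = "smult _"] gderiv_pow_mult gderiv_E) auto
    then have "poly ((gderiv G ^^ k) \<Psi>) x - poly ?q x =
        (\<Sum>u\<in>{..<A} \<times> S. l u * poly (Q k u) x * (poly (E (snd u)) x - e (snd u)))"
      by (simp add: poly_sum right_diff_distrib ac_simps flip: sum_subtractf)
    moreover have "p dvd \<dots>" using E_M[OF that(1)] by (intro dvd_sum dvd_mult) auto
    moreover have "p dvd poly ?q x"
      using l0 that(2) by (intro const_dvd_poly) (drule bspec, auto)
    ultimately have "p dvd (poly ((gderiv G ^^ k) \<Psi>) x - poly ?q x) + poly ?q x"
      by (simp only: dvd_add)
    then show ?thesis by (simp only: diff_add_cancel)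
  qed
  have "card M * D \<le> degree \<Psi>"
  proof (rule card_mult_le_degree[OF prime _ M \<Psi>_nonzero])
    show "Finite_Set.finite M" using M finite_subset by blast
    fix x w assume x: "x \<in> M" "order_mod p x w \<Psi>"
    \<comment> \<open>Uniqueness of the order transfers the degree bound to \<open>w\<close>, giving
      \<open>w < p\<close>.\<close>
    obtain v where v: "order_mod p x v \<Psi>" "v \<le> degree \<Psi>"
      using order_mod_obtain[OF prime \<Psi>_nonzero] .
    have "v = w"
      using order_mod_ge[OF prime] order_mod_imp_vanishes x(2) v(1) by (metis antisym)
    then show "D \<le> w"
      using v deg_\<Psi> H x G_M vanish by (intro order_mod_ge_gderiv[OF prime x(2), of G]) auto
  qed
  with deg_\<Psi> show ?thesis by simp
qed

end

section \<open>Products of powers as an exponential system\<close>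

text \<open>The logarithmic derivative of the product is the sum of \<open>k i\<close> times
  \<open>f i'/f i\<close>; multiplication by all the \<open>f i\<close> makes it a
  polynomial.\<close>

lemma gderiv_prod_power:
  fixes f :: "'i \<Rightarrow> int poly"
  assumes "finite I"
  shows "gderiv (\<Prod>i\<in>I. f i) (\<Prod>i\<in>I. f i ^ k i) =
    (\<Sum>i\<in>I. smult (int (k i)) (pderiv (f i) * (\<Prod>j\<in>I - {i}. f j))) * (\<Prod>i\<in>I. f i ^ k i)"
  unfolding gderiv_def pderiv_prod sum_distrib_left sum_distrib_right
proof (rule sum.cong)
  fix i assume i: "i \<in> I"
  have "f i * pderiv (f i ^ k i) = smult (int (k i)) (pderiv (f i) * f i ^ k i)"
  proof (cases "k i")
    case (Suc k')
    show ?thesis unfolding Suc pderiv_power_Suc by (simp add: ac_simps)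
  qed simp
  then have "(\<Prod>j\<in>I - {i}. f j) * (\<Prod>j\<in>I - {i}. f j ^ k j) * (f i * pderiv (f i ^ k i)) =
      (\<Prod>j\<in>I - {i}. f j) * (\<Prod>j\<in>I - {i}. f j ^ k j) * smult (int (k i)) (pderiv (f i) * f i ^ k i)"
    by simp
  then show "(\<Prod>i\<in>I. f i) * ((\<Prod>j\<in>I - {i}. f j ^ k j) * pderiv (f i ^ k i)) =
      smult (int (k i)) (pderiv (f i) * (\<Prod>j\<in>I - {i}. f j)) * (\<Prod>i\<in>I. f i ^ k i)"
    using prod.remove[OF assms i, of f] prod.remove[OF assms i, of "\<lambda>i. f i ^ k i"]
    by (simp add: ac_simps)
qed simp

lemma degree_prod_le:
  fixes q :: "'i \<Rightarrow> int poly"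
  shows "(\<And>i. i \<in> I \<Longrightarrow> degree (q i) \<le> d i) \<Longrightarrow> degree (\<Prod>i\<in>I. q i) \<le> (\<Sum>i\<in>I. d i)"
proof (induction I rule: infinite_finite_induct)
  case (insert i I)
  then have "degree (q i) \<le> d i" "degree (\<Prod>i\<in>I. q i) \<le> (\<Sum>i\<in>I. d i)" by auto
  then show ?case
    using insert.hyps degree_mult_le[of "q i" "\<Prod>i\<in>I. q i"] by simp
qed auto

text \<open>The index set is the box of exponent vectors with entries below \<open>B\<close>, and
  the coefficients \<open>P b\<close> get degree below its size \<open>N\<close>. Since
  \<open>y i\<close> is a root of \<open>f i\<close> alone, the order of \<open>E b\<close> there
  reveals \<open>b i\<close>, which gives separation.\<close>

lemma int_poly_card_bound:
  fixes p :: int and f :: "'i \<Rightarrow> int poly" and I :: "'i set" and d :: "'i \<Rightarrow> nat" and B D t :: nat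
  defines "N \<equiv> B ^ card I" and "m \<equiv> \<Sum>i\<in>I. d i"
  assumes p: "prime p" and I: "finite I"
    and deg: "\<And>i. i \<in> I \<Longrightarrow> degree (f i) \<le> d i"
    and root: "\<And>i. i \<in> I \<Longrightarrow> p dvd poly (f i) (y i)"
    and nonroot: "\<And>i j. i \<in> I \<Longrightarrow> j \<in> I \<Longrightarrow> j \<noteq> i \<Longrightarrow> \<not> p dvd poly (f j) (y i)"
    and f_nonzero: "\<And>i. i \<in> I \<Longrightarrow> \<not> [:p:] dvd f i"
    and M: "M \<subseteq> {0..<p}" "\<And>x i. x \<in> M \<Longrightarrow> i \<in> I \<Longrightarrow> \<not> p dvd poly (f i) x"
    and pow: "\<And>x i. x \<in> M \<Longrightarrow> i \<in> I \<Longrightarrow> p dvd poly (f i) x ^ t - c i"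
    and t: "(N + 1) * (N + N * m) \<le> t" "int t \<le> p"
    and D: "D * (N + D * m) < N * N"
    and H: "int (N + t * B * m) \<le> p"
  shows "card M * D \<le> N + t * B * m"
proof -
  define S where "S = I \<rightarrow>\<^sub>E {..<B}"
  define E where "E b = (\<Prod>i\<in>I. f i ^ (t * b i))" for b
  define G where "G = (\<Prod>i\<in>I. f i)"
  define s where "s b = (\<Sum>i\<in>I. smult (int (t * b i)) (pderiv (f i) * (\<Prod>j\<in>I - {i}. f j)))" for b
  have card_S: "card S = N" by (simp add: S_def card_PiE[OF I] N_def)
  have E_nonzero: "\<not> [:p:] dvd E b" for b
  proof -
    have "\<not> [:p:] dvd f i ^ k" if "i \<in> I" for i k
      using f_nonzero[OF that] prime_elem_dvd_power[OF prime_elem_const[OF p]] by blast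
    then show ?thesis unfolding E_def by (intro not_dvd_prod[OF p])
  qed
  interpret exponential_system p G m t S E s
  proof
    show "Finite_Set.finite S" by (simp add: S_def finite_PiE I)
    show "\<not> [:p:] dvd G" unfolding G_def by (intro not_dvd_prod[OF p] f_nonzero)
    show "degree G \<le> m" unfolding G_def m_def by (intro degree_prod_le deg)
    show "gderiv G (E b) = s b * E b" for b
      unfolding G_def E_def s_def by (rule gderiv_prod_power[OF I])
    show "degree (s b) \<le> m" for b
      unfolding s_def
    proof (intro degree_sum_le I order_trans[OF degree_smult_le])
      fix i assume i: "i \<in> I"
      have "degree (\<Prod>j\<in>I - {i}. f j) \<le> (\<Sum>j\<in>I - {i}. d j)" by (intro degree_prod_le deg) auto
      moreover have "m = d i + (\<Sum>j\<in>I - {i}. d j)" unfolding m_def by (rule sum.remove[OF I i])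
      ultimately show "degree (pderiv (f i) * (\<Prod>j\<in>I - {i}. f j)) \<le> m"
        using degree_mult_le[of "pderiv (f i)" "\<Prod>j\<in>I - {i}. f j"] deg[OF i] degree_pderiv[of "f i"]
        by linarith
    qed
    fix b b' R R'
    assume b: "b \<in> S" "b' \<in> S" "b \<noteq> b'" and dvd: "[:p:] dvd R * E b + R' * E b'"
      and deg: "degree R < t" "degree R' < t"
    show "[:p:] dvd R"
    proof (rule ccontr)
      assume R: "\<not> [:p:] dvd R"
      have R': "\<not> [:p:] dvd R'"
        using dvd R E_nonzero[of b] const_dvd_mult_iff[OF p]
        by (metis dvd_add_left_iff dvd_mult2)
      obtain i where i: "i \<in> I" "b i \<noteq> b' i" using b PiE_ext unfolding S_def by metis
      obtain e where e: "order_mod p (y i) e (f i)" using order_mod_obtain[OF p f_nonzero[OF i(1)]] .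
      have "e \<noteq> 0" using e root[OF i(1)] order_mod_0_iff[of p "y i" "f i"] by (cases e) auto
      obtain w where w: "order_mod p (y i) w R" "w \<le> degree R" using order_mod_obtain[OF p R] .
      obtain w' where w': "order_mod p (y i) w' R'" "w' \<le> degree R'" using order_mod_obtain[OF p R'] .
      have ord_E: "order_mod p (y i) (t * b i * e) (E b)" for b
      proof -
        have "order_mod p (y i) (\<Sum>j\<in>I. if j = i then t * b j * e else 0) (E b)"
          unfolding E_def
        proof (rule order_mod_prod[OF p])
          fix j assume j: "j \<in> I"
          have "order_mod p (y i) (if j = i then e else 0) (f j)"
            using e nonroot[OF i(1) j] by (auto simp: order_mod_0_iff)
          from order_mod_power[OF p this, of "t * b j"]
          show "order_mod p (y i) (if j = i then t * b j * e else 0) (f j ^ (t * b j))"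
            by (cases "j = i") auto
        qed
        then show ?thesis using I i by simp
      qed
      have o: "order_mod p (y i) (w + t * b i * e) (R * E b)"
        "order_mod p (y i) (w' + t * b' i * e) (R' * E b')"
        by (intro order_mod_mult[OF p] w w' ord_E)+
      \<comment> \<open>If \<open>q + q'\<close> is zero modulo \<open>p\<close>, then
        \<open>q'\<close> vanishes to at least the order of \<open>q\<close>; used in both
        directions this equates the two orders.\<close>
      have *: "vanishes_mod p (y i) v (- q + (q + q'))" if "order_mod p (y i) v q" "[:p:] dvd q + q'"
        for v q q'
      proof (rule vanishes_mod_add)
        show "vanishes_mod p (y i) v (- q)"
          using vanishes_mod_mult[OF order_mod_imp_vanishes[OF that(1)], of "- 1"] by simp
      qed (rule vanishes_mod_dvd[OF that(2)])
      have "w + t * b i * e \<le> w' + t * b' i * e"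
        using order_mod_ge[OF p o(2)] *[OF o(1) dvd] by simp
      moreover have "w' + t * b' i * e \<le> w + t * b i * e"
        using order_mod_ge[OF p o(1)] *[OF o(2), of "R * E b"] dvd by (simp add: add.commute)
      \<comment> \<open>Unequal exponents shift the order by at least \<open>t\<close>, which orders
        of \<open>R\<close> and \<open>R'\<close> below \<open>t\<close> cannot compensate.\<close>
      moreover have False if "w + t * a * e = w' + t * a' * e" "a < a'" "w < t" for w w' a a'
      proof -
        have "t * a * e + t * e \<le> t * a' * e"
          using that mult_le_mono[of "Suc a" a' "t * e" "t * e"] by (simp add: algebra_simps)
        moreover have "t \<le> t * e" using \<open>e \<noteq> 0\<close> by simp
        ultimately show False using that by linarith
      qed
      ultimately show False
        using i w w' deg by (metis antisym linorder_neqE_nat order_le_less_trans)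
    qed
  qed (use p E_nonzero in auto)
  show ?thesis
  proof (rule card_mult_le[where A = N and e = "\<lambda>b. \<Prod>i\<in>I. c i ^ b i"])
    show "(card S + 1) * (N + card S * m) \<le> t" "D * (N + D * m) < N * card S"
      using t D by (simp_all add: card_S)
    show "degree (E b) + N \<le> N + t * B * m" if b: "b \<in> S" for b
    proof -
      have "degree (E b) \<le> (\<Sum>i\<in>I. t * B * d i)"
        unfolding E_def
      proof (rule degree_prod_le)
        fix i assume i: "i \<in> I"
        have "b i \<le> B" using b i by (force simp: S_def)
        then have "degree (f i) * (t * b i) \<le> d i * (t * B)" by (intro mult_le_mono deg i order_refl)
        then show "degree (f i ^ (t * b i)) \<le> t * B * d i"
          using degree_power_le[of "f i" "t * b i"] by (simp only: ac_simps)
      qed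
      then show ?thesis by (simp add: m_def sum_distrib_left)
    qed
    show "\<not> p dvd poly G x" if "x \<in> M" for x
      unfolding G_def poly_prod using p M(2)[OF that] I by (simp add: prime_dvd_prod_iff)
    show "p dvd poly (E b) x - (\<Prod>i\<in>I. c i ^ b i)" if "x \<in> M" "b \<in> S" for x b
    proof -
      have "(\<Prod>i\<in>I. poly (f i) x ^ (t * b i)) mod p = (\<Prod>i\<in>I. c i ^ b i) mod p"
      proof -
        have "poly (f i) x ^ (t * b i) mod p = c i ^ b i mod p" if "i \<in> I" for i
        proof -
          have "poly (f i) x ^ t mod p = c i mod p"
            using pow \<open>x \<in> M\<close> that by (simp add: mod_eq_dvd_iff)
          then show ?thesis unfolding power_mult by (metis power_mod)
        qed
        then have "(\<Prod>i\<in>I. poly (f i) x ^ (t * b i) mod p) mod p = (\<Prod>i\<in>I. c i ^ b i mod p) mod p"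
          by simp
        then show ?thesis by (simp only: mod_prod_eq)
      qed
      then show ?thesis by (simp add: E_def poly_prod mod_eq_dvd_iff)
    qed
  qed (fact t(2) H M(1))+
qed

section \<open>Choice of parameters and transfer to residue rings\<close>

text \<open>\<open>N = B ^ n\<close> is about the square root of \<open>t / (4 * m)\<close> and
  \<open>D\<close> about \<open>N / (2 * m)\<close>. The quotient of \<open>N + t * B * m\<close> by
  \<open>D\<close> is then of size \<open>t / B ^ (n - 1)\<close>, which is \<open>t\<close> to the
  power \<open>1 / 2 + 1 / (2 * n)\<close> up to a constant.\<close>

lemma stepanov_parameters:
  fixes n m t :: nat and p :: real
  assumes n: "1 \<le> n" and m: "1 \<le> m" and p: "0 < p"
    and t1: "real (4 * m * (2 * m) ^ (2 * n)) < real t"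
    and t2: "real t < 1 / real (2 * m) * p powr (1 - 1 / (2 * real n + 1))"
  obtains B D where "(B ^ n + 1) * (B ^ n + B ^ n * m) \<le> t"
    and "D * (B ^ n + D * m) < B ^ n * B ^ n"
    and "real (B ^ n + t * B * m) \<le> p"
    and "real t \<le> p"
    and "\<And>k. k * D \<le> B ^ n + t * B * m \<Longrightarrow>
      real k \<le> real (32 * m ^ 3 * 2 ^ n) * real t powr (1 / 2 + 1 / (2 * real n))"
proof -
  have t0: "0 < real t" using t1 by (rule le_less_trans[rotated]) simp
  define x where "x = (real t / (4 * real m)) powr (1 / (2 * real n))"
  define B where "B = nat \<lfloor>x\<rfloor>"
  define N where "N = B ^ n"
  define D where "D = N div (2 * m)"
  \<comment> \<open>The lower bound on \<open>t\<close> ensures \<open>x \<ge> 2 * m\<close>, hence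
    \<open>D \<ge> 1\<close> further on.\<close>
  have quot: "real (2 * m) ^ (2 * n) \<le> real t / (4 * real m)"
    using t1 m by (simp add: field_simps)
  have x_pow: "x ^ (2 * n) = real t / (4 * real m)"
    unfolding x_def using n m t0 by (simp add: powr_power)
  have x_ge: "real (2 * m) \<le> x"
  proof (rule power_le_imp_le_base)
    show "real (2 * m) ^ Suc (2 * n - 1) \<le> x ^ Suc (2 * n - 1)" using quot x_pow n by simp
  qed (simp add: x_def)
  have x1: "1 \<le> x" using x_ge m by linarith
  have B_le: "real B \<le> x" using x1 by (simp add: B_def)
  have B_ge: "2 * m \<le> B" unfolding B_def using x_ge by (simp add: le_nat_iff le_floor_iff)
  have x_le: "x \<le> 2 * real B"
  proof -
    have "x < real B + 1" using x1 by (simp add: B_def)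
    moreover have "1 \<le> B" using B_ge m by linarith
    ultimately show ?thesis by linarith
  qed
  have "B \<noteq> 0" using B_ge m by linarith
  then have "B \<le> N" unfolding N_def using n by (intro self_le_power) auto
  then have N: "2 * m \<le> N" "1 \<le> N" using B_ge m by linarith+
  have N2: "4 * m * (N * N) \<le> t"
  proof -
    have "real (N * N) = real B ^ (2 * n)" by (simp add: N_def power_mult power2_eq_square power_mult_distrib)
    also have "\<dots> \<le> real t / (4 * real m)"
      unfolding x_pow[symmetric] using B_le by (intro power_mono) auto
    finally have "real (4 * m * (N * N)) \<le> real t" using m by (simp add: field_simps)
    then show ?thesis by (simp only: of_nat_le_iff)
  qed
  have 1: "(N + 1) * (N + N * m) \<le> t"
  proof -
    have "(N + 1) * (N + N * m) \<le> (2 * N) * (2 * (N * m))"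
      using N m by (intro mult_mono) auto
    also have "\<dots> = 4 * m * (N * N)" by simp
    finally show ?thesis using N2 by linarith
  qed
  have Dm: "2 * (D * m) \<le> N"
    using times_div_less_eq_dividend[of "2 * m" N] by (simp add: D_def ac_simps)
  have 2: "D * (N + D * m) < N * N"
  proof -
    have "D * 1 \<le> D * m" using m by (intro mult_le_mono2)
    then have "2 * D \<le> N" using Dm by linarith
    then have "2 * D * (2 * N + 2 * (D * m)) \<le> N * (2 * N + N)"
      using Dm by (intro mult_mono add_mono) auto
    moreover have "2 * D * (2 * N + 2 * (D * m)) = 4 * (D * (N + D * m))" "N * (2 * N + N) = 3 * (N * N)"
      by (simp_all add: algebra_simps)
    moreover have "0 < N * N" using N by simp
    ultimately show ?thesis by linarith
  qed
  have "N \<le> t" "N \<le> t * B * m"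
  proof -
    show "N \<le> t" using 1 by (simp add: algebra_simps)
    moreover have "t \<le> t * (B * m)" using \<open>B \<noteq> 0\<close> m by simp
    ultimately show "N \<le> t * B * m" unfolding mult.assoc by (rule order_trans)
  qed
  have H: "real (N + t * B * m) \<le> 2 * real m * (real t * real B)"
  proof -
    have "N + t * B * m \<le> 2 * m * (t * B)" using \<open>N \<le> t * B * m\<close> by (simp add: ac_simps)
    then have "real (N + t * B * m) \<le> real (2 * m * (t * B))" by (rule of_nat_mono)
    then show ?thesis by simp
  qed
  have p_bound: "2 * real m * (real t * real B) \<le> p"
  proof -
    \<comment> \<open>The exponent inverse to \<open>1 - 1 / (2 * n + 1)\<close>:
      \<open>t * B\<close> is at most \<open>t powr \<alpha>\<close>, and raising the upper bound on
      \<open>t\<close> to this power bounds it by \<open>p / (2 * m)\<close>.\<close>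
    define \<alpha> where "\<alpha> = 1 + 1 / (2 * real n)"
    have "(1 - 1 / (z + 1)) * (1 + 1 / z) = 1" if "0 < z" for z :: real
    proof -
      have "1 - 1 / (z + 1) = z / (z + 1)" "1 + 1 / z = (z + 1) / z" "z + 1 \<noteq> 0"
        using that by (simp_all add: field_simps)
      then show ?thesis using that by simp
    qed
    from this[of "2 * real n"] have \<alpha>: "(1 - 1 / (2 * real n + 1)) * \<alpha> = 1" "1 \<le> \<alpha>"
      using n by (simp_all add: \<alpha>_def)
    have "x \<le> real t powr (1 / (2 * real n))"
      unfolding x_def using m t0 by (intro powr_mono2) (auto simp: field_simps)
    then have "real t * real B \<le> real t * real t powr (1 / (2 * real n))"
      using B_le t0 by (intro mult_left_mono) auto
    also have "\<dots> = real t powr \<alpha>" using t0 by (simp add: \<alpha>_def powr_add)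
    also have "\<dots> \<le> (1 / real (2 * m) * p powr (1 - 1 / (2 * real n + 1))) powr \<alpha>"
      using t0 t2 \<alpha> by (intro powr_mono2) auto
    also have "\<dots> = (1 / real (2 * m)) powr \<alpha> * p"
      using \<alpha> p m by (subst powr_mult) (simp_all add: powr_powr)
    also have "(1 / real (2 * m)) powr \<alpha> \<le> (1 / real (2 * m)) powr 1"
      using \<alpha> m by (intro powr_mono') auto
    finally show ?thesis using p m by (simp add: field_simps)
  qed
  have 3: "real (N + t * B * m) \<le> p" using H p_bound by linarith
  have 4: "real t \<le> p"
  proof -
    have "t \<le> t * (B * m)" using \<open>B \<noteq> 0\<close> m by simp
    then have "t \<le> N + t * B * m" unfolding mult.assoc by (rule trans_le_add2)
    then have "real t \<le> real (N + t * B * m)" by (rule of_nat_mono)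
    with 3 show ?thesis by linarith
  qed
  have 5: "real k \<le> real (32 * m ^ 3 * 2 ^ n) * real t powr (1 / 2 + 1 / (2 * real n))"
    if "k * D \<le> N + t * B * m" for k
  proof -
    have "D \<ge> 1" using N m by (simp add: D_def div_greater_zero_iff Suc_le_eq)
    \<comment> \<open>Rounding down in \<open>D\<close> costs at most a factor 2, as
      \<open>D \<ge> 1\<close>.\<close>
    have "N \<le> 4 * m * D"
    proof -
      have "N < 2 * m * (D + 1)"
        using m dividend_less_times_div[of "2 * m" N] by (simp add: D_def)
      also have "\<dots> \<le> 2 * m * (D + D)" using \<open>D \<ge> 1\<close> by (intro mult_left_mono) auto
      also have "\<dots> = 4 * m * D" by simp
      finally show ?thesis by (rule less_imp_le)
    qed
    then have "k * N \<le> k * (4 * m * D)" by (rule mult_le_mono2)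
    also have "\<dots> = 4 * m * (k * D)" by simp
    also have "\<dots> \<le> 4 * m * (2 * (t * B * m))"
      using that \<open>N \<le> t * B * m\<close> by (intro mult_left_mono) auto
    finally have "B * (k * B ^ (n - 1)) \<le> B * (8 * m\<^sup>2 * t)"
      using n unfolding N_def by (cases n) (auto simp: power2_eq_square ac_simps)
    then have "k * B ^ (n - 1) \<le> 8 * m\<^sup>2 * t" using \<open>B \<noteq> 0\<close> by simp
    have kB: "real k * real B ^ (n - 1) \<le> 8 * (real m)\<^sup>2 * real t"
    proof -
      have "real (k * B ^ (n - 1)) \<le> real (8 * m\<^sup>2 * t)"
        using \<open>k * B ^ (n - 1) \<le> 8 * m\<^sup>2 * t\<close> by (rule of_nat_mono)
      then show ?thesis by simp
    qed
    \<comment> \<open>The complement to 1 of the target exponent. Replacing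
      \<open>B ^ (n - 1)\<close> by \<open>t powr \<beta>\<close> costs
      \<open>4 * m * 2 ^ n\<close>, which with \<open>8 * m\<^sup>2\<close> makes up the
      constant.\<close>
    define \<beta> where "\<beta> = (real n - 1) / (2 * real n)"
    have \<beta>: "0 \<le> \<beta>" "\<beta> \<le> 1" using n by (auto simp: \<beta>_def field_simps)
    have "x ^ (n - 1) = (real t / (4 * real m)) powr \<beta>"
      using n m t0 by (simp add: x_def powr_power \<beta>_def of_nat_diff)
    also have "\<dots> = real t powr \<beta> / (4 * real m) powr \<beta>"
      using m t0 by (simp add: powr_divide)
    finally have x_n: "real t powr \<beta> = (4 * real m) powr \<beta> * x ^ (n - 1)" using m by simp
    have "(4 * real m) powr \<beta> \<le> (4 * real m) powr 1"
      using m \<beta> by (intro powr_mono) auto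
    then have "real t powr \<beta> \<le> 4 * real m * x ^ (n - 1)"
      unfolding x_n using m x1 by (intro mult_right_mono) auto
    also have "x ^ (n - 1) \<le> (2 * real B) ^ (n - 1)" using x_le x1 by (intro power_mono) auto
    also have "\<dots> \<le> 2 ^ n * real B ^ (n - 1)"
      unfolding power_mult_distrib by (intro mult_right_mono power_increasing) auto
    finally have "real t powr \<beta> \<le> 4 * real m * (2 ^ n * real B ^ (n - 1))" using m by simp
    then have "real k * real t powr \<beta> \<le> real k * (4 * real m * (2 ^ n * real B ^ (n - 1)))"
      by (intro mult_left_mono) auto
    also have "\<dots> = 4 * real m * 2 ^ n * (real k * real B ^ (n - 1))" by simp
    also have "\<dots> \<le> 4 * real m * 2 ^ n * (8 * (real m)\<^sup>2 * real t)"
      using kB by (intro mult_left_mono) auto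
    also have "\<dots> = real (32 * m ^ 3 * 2 ^ n) * real t"
      by (simp add: power2_eq_square power3_eq_cube)
    also have "\<dots> = (real (32 * m ^ 3 * 2 ^ n) * real t powr (1 / 2 + 1 / (2 * real n))) * real t powr \<beta>"
    proof -
      have "1 / 2 + 1 / (2 * real n) + \<beta> = 1" using n by (simp add: \<beta>_def field_simps)
      then have "real t powr (1 / 2 + 1 / (2 * real n)) * real t powr \<beta> = real t"
        using t0 by (simp flip: powr_add)
      then show ?thesis by (simp only: mult.assoc)
    qed
    finally have "real k * real t powr \<beta> \<le>
        (real (32 * m ^ 3 * 2 ^ n) * real t powr (1 / 2 + 1 / (2 * real n))) * real t powr \<beta>" .
    then show ?thesis using t0 by (simp only: mult_le_cancel_right_pos powr_gt_zero)
  qed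
  show thesis by (rule that[of B D]) (use 1 2 3 4 5 in \<open>simp_all add: N_def\<close>)
qed

section \<open>Transfer to the field with p elements\<close>

text \<open>\<open>rev\<close> reconciles coefficient lists with leading coefficient first with
  \<open>Poly\<close>, which expects the constant term first.\<close>

lemma eval_residue_ring:
  assumes "residues m"
  shows "ring.eval (residue_ring m) f x = poly (Poly (rev f)) x mod m"
proof -
  interpret residues m "residue_ring m" by (rule assms) simp
  have pow: "x [^]\<^bsub>residue_ring m\<^esub> (k :: nat) mod m = x ^ k mod m" for k
    by (induction k) (simp_all add: res_mult_eq res_one_eq, metis mod_mult_left_eq mult.commute)
  show ?thesis
  proof (induction f)
    case (Cons a f)
    have "ring.eval (residue_ring m) (a # f) x =
        (a * x [^]\<^bsub>residue_ring m\<^esub> length f + poly (Poly (rev f)) x) mod m"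
      using Cons by (simp add: res_mult_eq res_add_eq mod_add_eq)
    also have "\<dots> = (a * x ^ length f + poly (Poly (rev f)) x) mod m"
      by (metis pow mod_add_left_eq mod_mult_right_eq)
    finally show ?case by (simp add: Poly_append poly_monom ac_simps)
  qed (simp add: res_zero_eq)
qed

lemma degree_Poly_rev: "Polynomial.degree (Poly (rev f)) \<le> length f - 1"
  by (intro degree_le) (auto simp: nth_default_def)

text \<open>Lagrange: writing \<open>x = g * h\<close> with \<open>h\<close> in the subgroup,
  \<open>h ^ card \<Gamma>\<close> is 1 modulo \<open>p\<close>.\<close>

lemma coset_pow_cong:
  assumes p: "Factorial_Ring.prime (p :: nat)" and \<Gamma>: "subgroup \<Gamma> (Fp_star p)"
    and g: "g \<in> carrier (Fp_star p)" and x: "x \<in> g <#\<^bsub>Fp_star p\<^esub> \<Gamma>"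
  shows "int p dvd x ^ card \<Gamma> - g ^ card \<Gamma>" and "\<not> int p dvd x"
proof -
  interpret residues_prime p "Fp p" using p by unfold_locales auto
  interpret G: group "Fp_star p" by (rule field_mult_group)
  obtain h where h: "h \<in> \<Gamma>" "x = (g * h) mod int p"
    using x by (auto simp: l_coset_def res_mult_eq)
  have pow: "h [^]\<^bsub>Fp_star p\<^esub> (k :: nat) mod int p = h ^ k mod int p" for k
    by (induction k) (simp_all add: res_mult_eq res_one_eq, metis mod_mult_left_eq mult.commute)
  have "h [^]\<^bsub>Fp_star p\<^esub> card \<Gamma> = \<one>\<^bsub>Fp_star p\<^esub>"
  proof -
    interpret H: group "(Fp_star p)\<lparr>carrier := \<Gamma>\<rparr>" by (rule G.subgroup_imp_group[OF \<Gamma>])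
    show ?thesis using H.pow_order_eq_1[of h] h(1)
      by (simp add: Coset.order_def flip: G.nat_pow_consistent)
  qed
  then have "h ^ card \<Gamma> mod int p = 1 mod int p" using pow[of "card \<Gamma>"] by (simp add: res_one_eq)
  then have "(g ^ card \<Gamma> * h ^ card \<Gamma>) mod int p = (g ^ card \<Gamma> * 1) mod int p"
    by (metis mod_mult_right_eq)
  then have "x ^ card \<Gamma> mod int p = g ^ card \<Gamma> mod int p"
    by (simp add: h(2) power_mod power_mult_distrib)
  then show "int p dvd x ^ card \<Gamma> - g ^ card \<Gamma>" by (simp add: mod_eq_dvd_iff)
  have "h \<in> carrier (Fp_star p)" using subgroup.mem_carrier[OF \<Gamma> h(1)] .
  then have "\<not> int p dvd g" "\<not> int p dvd h"
    using g by (auto simp: res_carrier_eq res_zero_eq dest: zdvd_imp_le)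
  then show "\<not> int p dvd x" using p by (simp add: h(2) dvd_mod_iff prime_dvd_mult_iff)
qed

theorem theorem2:
  fixes n :: nat and m :: "nat \<Rightarrow> nat"
  assumes "n \<ge> 2"
    and "m \<in> {1..n} \<rightarrow>\<^sub>E {1..}"
  shows "\<exists>C\<^sub>1 C\<^sub>2 C\<^sub>3 :: real. C\<^sub>1 > 0 \<and> C\<^sub>2 > 0 \<and> C\<^sub>3 > 0 \<and>
    (\<forall>(p :: nat) (\<Gamma> :: int set) (\<Gamma>s :: nat \<Rightarrow> int set) (f :: nat \<Rightarrow> int list).
      Factorial_Ring.prime p \<longrightarrow>
      subgroup \<Gamma> (Fp_star p) \<longrightarrow>
      (\<forall>i\<in>{1..n}. \<exists>g\<in>carrier (Fp_star p). \<Gamma>s i = g <#\<^bsub>Fp_star p\<^esub> \<Gamma>) \<longrightarrow>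
      admissible_polys p n f \<longrightarrow>
      (\<forall>i\<in>{1..n}. Polynomials.degree (f i) = m i) \<longrightarrow>
      C\<^sub>1 < real (card \<Gamma>) \<longrightarrow>
      real (card \<Gamma>) < C\<^sub>2 * real p powr (1 - 1 / (2 * real n + 1)) \<longrightarrow>
      real (card {x \<in> carrier (Fp p). \<forall>i\<in>{1..n}. ring.eval (Fp p) (f i) x \<in> \<Gamma>s i})
        \<le> C\<^sub>3 * real (card \<Gamma>) powr (1 / 2 + 1 / (2 * real n)))"
proof -
  \<comment> \<open>The degree bound for the product of the polynomials; all three constants depend
    on \<open>n\<close> and \<open>d\<close> only.\<close>
  define d where "d = (\<Sum>i\<in>{1..n}. m i)"
  have d: "1 \<le> d"
  proof -
    have "1 \<le> m 1" using assms by (auto dest: PiE_mem[of _ _ _ 1])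
    also have "\<dots> \<le> d" unfolding d_def using assms(1) by (intro member_le_sum) auto
    finally show ?thesis .
  qed
  have bound: "real (card {x \<in> carrier (Fp p). \<forall>i\<in>{1..n}. ring.eval (Fp p) (f i) x \<in> \<Gamma>s i})
      \<le> real (32 * d ^ 3 * 2 ^ n) * real (card \<Gamma>) powr (1 / 2 + 1 / (2 * real n))"
    if p: "Factorial_Ring.prime p" and \<Gamma>: "subgroup \<Gamma> (Fp_star p)"
      and \<Gamma>s: "\<forall>i\<in>{1..n}. \<exists>g\<in>carrier (Fp_star p). \<Gamma>s i = g <#\<^bsub>Fp_star p\<^esub> \<Gamma>"
      and adm: "admissible_polys p n f"
      and deg: "\<forall>i\<in>{1..n}. Polynomials.degree (f i) = m i"
      and t1: "real (4 * d * (2 * d) ^ (2 * n)) < real (card \<Gamma>)"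
      and t2: "real (card \<Gamma>) < 1 / real (2 * d) * real p powr (1 - 1 / (2 * real n + 1))"
    for p \<Gamma> \<Gamma>s f
  proof -
    interpret residues_prime p "Fp p" using p by unfold_locales auto
    define F where "F i = Poly (rev (f i))" for i
    let ?M = "{x \<in> carrier (Fp p). \<forall>i\<in>{1..n}. ring.eval (Fp p) (f i) x \<in> \<Gamma>s i}"
    have eval: "ring.eval (Fp p) (f i) x = poly (F i) x mod int p" for i x
      unfolding F_def by (rule eval_residue_ring) (rule residues_axioms)
    have eval_0: "ring.eval (Fp p) (f i) x = \<zero>\<^bsub>Fp p\<^esub> \<longleftrightarrow> int p dvd poly (F i) x" for i x
      by (simp add: eval res_zero_eq dvd_eq_mod_eq_0)
    obtain g where g: "\<And>i. i \<in> {1..n} \<Longrightarrow> g i \<in> carrier (Fp_star p)"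
        "\<And>i. i \<in> {1..n} \<Longrightarrow> \<Gamma>s i = g i <#\<^bsub>Fp_star p\<^esub> \<Gamma>"
      using bchoice[OF \<Gamma>s[unfolded Bex_def]] by blast
    obtain y where y: "\<And>i. i \<in> {1..n} \<Longrightarrow> int p dvd poly (F i) (y i)"
        "\<And>i j. i \<in> {1..n} \<Longrightarrow> j \<in> {1..n} \<Longrightarrow> j \<noteq> i \<Longrightarrow> \<not> int p dvd poly (F j) (y i)"
      and nz: "\<And>i. i \<in> {1..n} \<Longrightarrow> \<not> int p dvd poly (F i) 0"
    proof -
      have "\<exists>y. \<forall>i\<in>{1..n}. int p dvd poly (F i) (y i) \<and>
          (\<forall>j\<in>{1..n}. j \<noteq> i \<longrightarrow> \<not> int p dvd poly (F j) (y i))"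
        using adm unfolding admissible_polys_def eval_0 by blast
      moreover have "\<forall>i\<in>{1..n}. \<not> int p dvd poly (F i) 0"
        using adm unfolding admissible_polys_def eval_0 by (simp add: res_zero_eq)
      ultimately show ?thesis using that by blast
    qed
    have at_M: "\<not> int p dvd poly (F i) x"
        "int p dvd poly (F i) x ^ card \<Gamma> - g i ^ card \<Gamma>"
      if "x \<in> ?M" "i \<in> {1..n}" for x i
    proof -
      have "poly (F i) x mod int p \<in> g i <#\<^bsub>Fp_star p\<^esub> \<Gamma>"
        using that g(2) by (auto simp: eval)
      note * = coset_pow_cong[OF p \<Gamma> g(1)[OF that(2)] this]
      show "\<not> int p dvd poly (F i) x" using *(2) by (simp add: dvd_mod_iff)
      show "int p dvd poly (F i) x ^ card \<Gamma> - g i ^ card \<Gamma>"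
        using *(1) by (simp add: mod_eq_dvd_iff[symmetric] power_mod)
    qed
    have "1 \<le> n" "0 < real p" using assms(1) p prime_gt_0_nat by auto
    then obtain B D where BD: "(B ^ n + 1) * (B ^ n + B ^ n * d) \<le> card \<Gamma>"
        "D * (B ^ n + D * d) < B ^ n * B ^ n"
        "real (B ^ n + card \<Gamma> * B * d) \<le> real p"
        "real (card \<Gamma>) \<le> real p"
      and bound: "\<And>k. k * D \<le> B ^ n + card \<Gamma> * B * d \<Longrightarrow>
        real k \<le> real (32 * d ^ 3 * 2 ^ n) * real (card \<Gamma>) powr (1 / 2 + 1 / (2 * real n))"
      using stepanov_parameters[OF _ d _ t1 t2] by metis
    have "card ?M * D \<le> B ^ card {1..n} + card \<Gamma> * B * (\<Sum>i\<in>{1..n}. m i)"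
    proof (rule int_poly_card_bound[where f = F and p = "int p" and y = y and c = "\<lambda>i. g i ^ card \<Gamma>"])
      show "Factorial_Ring.prime (int p)" using p by simp
      show "Polynomial.degree (F i) \<le> m i" if "i \<in> {1..n}" for i
        using degree_Poly_rev[of "f i"] deg that by (simp add: F_def)
      \<comment> \<open>Nonvanishing at 0 excludes the zero polynomial.\<close>
      show "\<not> [:int p:] dvd F i" if "i \<in> {1..n}" for i
        using nz[OF that] const_dvd_poly by blast
      show "?M \<subseteq> {0..<int p}" by (auto simp: res_carrier_eq)
      show "int (card \<Gamma>) \<le> int p" using BD(4) by simp
      show "int (B ^ card {1..n} + card \<Gamma> * B * (\<Sum>i\<in>{1..n}. m i)) \<le> int p"
        using BD(3) unfolding d_def[symmetric] card_atLeastAtMost of_nat_le_iff by simp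
      show "(B ^ card {1..n} + 1) * (B ^ card {1..n} + B ^ card {1..n} * (\<Sum>i\<in>{1..n}. m i)) \<le> card \<Gamma>"
        "D * (B ^ card {1..n} + D * (\<Sum>i\<in>{1..n}. m i)) < B ^ card {1..n} * B ^ card {1..n}"
        using BD(1,2) unfolding d_def[symmetric] by simp_all
    qed (use y at_M in \<open>simp_all\<close>)
    then show ?thesis by (intro bound) (simp add: d_def)
  qed
  have pos: "0 < real (4 * d * (2 * d) ^ (2 * n))" "0 < 1 / real (2 * d)" "0 < real (32 * d ^ 3 * 2 ^ n)"
    using d by auto
  show ?thesis
    by (intro exI[of _ "real (4 * d * (2 * d) ^ (2 * n))"] exI[of _ "1 / real (2 * d)"]
        exI[of _ "real (32 * d ^ 3 * 2 ^ n)"] conjI pos allI impI) (rule bound)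
qed

end
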